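(* For every non-negative integer $n$, $p_{2,3}(n)-p_{10,15}(n-4)$ equals the number of pairs $(\mu,\lambda)$ with $|\mu|+|\lambda|=n$, where $\mu$ is a partition into distinct parts each $\equiv \pm8,\pm12 \pmod{40}$ and $\lambda$ is a partition into parts each $\not\equiv 0,\pm3,\pm4,\pm7,\pm10,\pm13,\pm17,20 \pmod{40}$. Equivalently, $$\sum_{n\ge0}\big(p_{2,3}(n)-p_{10,15}(n-4)\big)q^n=\frac{\prod_{m\ge1,\ m\equiv\pm8,\pm12\ (\mathrm{mod}\ 40)}(1+q^m)}{\prod_{m\ge1,\ m\not\equiv 0,\pm3,\pm4,\pm7,\pm10,\pm13,\pm17,20\ (\mathrm{mod}\ 40)}(1-q^m)}.$$
   Context: A partition of $n$ is a finite multiset of positive integers summing to $n$; $|\lambda|$ denotes the sum of the parts of $\lambda$. For positive integers $A,a$ and a partition $\pi$, $\mathrm{mex}_{A,a}(\pi)$ is the smallest element of $\{a,a+A,a+2A,\dots\}$ that is not a part of $\pi$. $p_{A,a}(n)$ is the number of partitions $\pi$ of $n$ with $\mathrm{mex}_{A,a}(\pi)\equiv a \pmod{2A}$; by convention $p_{A,a}(0)=1$ and $p_{A,a}(m)=0$ for $m<0$. *)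

theory Defs
  imports
    "HOL-Analysis.Analysis"
    "HOL-Computational_Algebra.Formal_Power_Series"
    "HOL-Library.Multiset"
    "HOL-Number_Theory.Cong"
begin

definition is_partition :: "nat multiset \<Rightarrow> bool" where
  "is_partition \<pi> \<longleftrightarrow> (\<forall>x\<in>#\<pi>. 0 < x)"

definition distinct_parts :: "nat multiset \<Rightarrow> bool" where
  "distinct_parts \<pi> \<longleftrightarrow> (\<forall>x\<in>#\<pi>. count \<pi> x = 1)"

definition mex :: "nat \<Rightarrow> nat \<Rightarrow> nat multiset \<Rightarrow> nat" where
  "mex A a \<pi> = (LEAST x. x \<in> {a + k * A | k. True} \<and> x \<notin># \<pi>)"

text \<open>The argument \<open>n\<close> is an integer so that \<open>n - 4\<close> may be negative; the conventional
  values at \<open>0\<close> and at negative \<open>n\<close> need no separate clauses, see \<open>pmex_0\<close> and \<open>pmex_neg\<close>.\<close>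

definition pmex :: "nat \<Rightarrow> nat \<Rightarrow> int \<Rightarrow> nat" where
  "pmex A a n = card {\<pi>. is_partition \<pi> \<and> int (sum_mset \<pi>) = n \<and> [mex A a \<pi> = a] (mod 2 * A)}"

definition mu_residue :: "nat \<Rightarrow> bool" where
  "mu_residue m \<longleftrightarrow> (\<exists>r\<in>{8, -8, 12, -12}. [int m = r] (mod 40))"

definition nu_residue :: "nat \<Rightarrow> bool" where
  "nu_residue m \<longleftrightarrow>
     \<not> (\<exists>r\<in>{0, 3, -3, 4, -4, 7, -7, 10, -10, 13, -13, 17, -17, 20}. [int m = r] (mod 40))"

definition partition_pairs :: "nat \<Rightarrow> (nat multiset \<times> nat multiset) set" where
  "partition_pairs n = {(\<mu>, \<nu>).
     is_partition \<mu> \<and> distinct_parts \<mu> \<and> (\<forall>x\<in>#\<mu>. mu_residue x) \<and>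
     is_partition \<nu> \<and> (\<forall>x\<in>#\<nu>. nu_residue x) \<and>
     sum_mset \<mu> + sum_mset \<nu> = n}"

text \<open>The factor at index \<open>m\<close> is \<open>1\<close> when \<open>m\<close> is not in the index set of the product.\<close>

definition num_factor :: "nat \<Rightarrow> rat fps" where
  "num_factor m = (if 1 \<le> m \<and> mu_residue m then 1 + fps_X ^ m else 1)"

definition den_factor :: "nat \<Rightarrow> rat fps" where
  "den_factor m = (if 1 \<le> m \<and> nu_residue m then 1 - fps_X ^ m else 1)"


subsection \<open>Well-definedness\<close>

lemma mex_in_and_notin:
  assumes "0 < A"
  shows "(\<exists>k. mex A a \<pi> = a + k * A) \<and> mex A a \<pi> \<notin># \<pi>"
proof -
  have "inj (\<lambda>k. a + k * A)"
    using assms by (auto simp: inj_on_def)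
  then have "infinite (range (\<lambda>k. a + k * A))"
    by (simp add: finite_image_iff)
  then have "\<not> range (\<lambda>k. a + k * A) \<subseteq> set_mset \<pi>"
    using finite_subset by blast
  then have "\<exists>x. x \<in> {a + k * A | k. True} \<and> x \<notin># \<pi>"
    by auto
  from LeastI_ex[OF this] show ?thesis
    unfolding mex_def by blast
qed

lemma pmex_0:
  assumes "0 < A"
  shows "pmex A a 0 = 1"
proof -
  have "mex A a {#} = a"
    unfolding mex_def
  proof (rule Least_equality)
    show "a \<in> {a + k * A | k. True} \<and> a \<notin># {#}"
      using mult_0[of A] by force
  qed auto
  then have "[mex A a {#} = a] (mod 2 * A)"
    by simp
  moreover have zero: "is_partition \<pi> \<and> int (sum_mset \<pi>) = 0 \<longleftrightarrow> \<pi> = {#}" for \<pi>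
    by (cases \<pi>) (auto simp: is_partition_def simp del: of_nat_sum_mset)
  moreover have "(is_partition \<pi> \<and> int (sum_mset \<pi>) = 0 \<and> [mex A a \<pi> = a] (mod 2 * A)) \<longleftrightarrow>
      \<pi> = {#} \<and> [mex A a \<pi> = a] (mod 2 * A)" for \<pi>
    using zero[of \<pi>] by argo
  ultimately have "{\<pi>. is_partition \<pi> \<and> int (sum_mset \<pi>) = 0 \<and> [mex A a \<pi> = a] (mod 2 * A)} = {{#}}"
    by (simp only:) auto
  then show ?thesis
    unfolding pmex_def by (simp only: card.empty card.insert) simp
qed

lemma pmex_neg: "n < 0 \<Longrightarrow> pmex A a n = 0"
proof -
  assume "n < 0"
  then have "{\<pi>. is_partition \<pi> \<and> int (sum_mset \<pi>) = n \<and> [mex A a \<pi> = a] (mod 2 * A)} = {}"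
    by (auto simp del: of_nat_sum_mset)
  then show ?thesis
    unfolding pmex_def by (simp only: card.empty)
qed

lemma size_le_sum_mset:
  assumes "is_partition \<pi>"
  shows "size \<pi> \<le> sum_mset \<pi>"
  using assms by (induction \<pi>) (auto simp: is_partition_def)

lemma finite_partitions_le: "finite {\<pi>. is_partition \<pi> \<and> sum_mset \<pi> \<le> n}"
proof (rule finite_subset)
  show "{\<pi>. is_partition \<pi> \<and> sum_mset \<pi> \<le> n}
      \<subseteq> mset ` {xs. set xs \<subseteq> {..n} \<and> length xs \<le> n}"
  proof
    fix \<pi> :: "nat multiset"
    assume \<pi>: "\<pi> \<in> {\<pi>. is_partition \<pi> \<and> sum_mset \<pi> \<le> n}"
    obtain xs where xs: "mset xs = \<pi>"
      using ex_mset by blast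
    have "x \<le> n" if "x \<in># \<pi>" for x
      using \<pi> sum_mset.remove[OF that] by auto
    moreover have "size \<pi> \<le> n"
      using \<pi> size_le_sum_mset[of \<pi>] by auto
    ultimately show "\<pi> \<in> mset ` {xs. set xs \<subseteq> {..n} \<and> length xs \<le> n}"
      using xs by (intro image_eqI[of _ _ xs]) auto
  qed
  show "finite (mset ` {xs. set xs \<subseteq> {..n} \<and> length xs \<le> n})"
    by (intro finite_imageI finite_lists_length_le) simp
qed

lemma finite_pmex_set: "finite {\<pi>. is_partition \<pi> \<and> int (sum_mset \<pi>) = n \<and> [mex A a \<pi> = a] (mod 2 * A)}"
  by (rule finite_subset[OF _ finite_partitions_le[of "nat n"]]) (auto simp del: of_nat_sum_mset)

lemma finite_partition_pairs: "finite (partition_pairs n)"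
  by (rule finite_subset[OF _ finite_cartesian_product[OF finite_partitions_le[of n] finite_partitions_le[of n]]])
     (auto simp: partition_pairs_def)

lemma convergent_prod_fps:
  fixes f :: "nat \<Rightarrow> 'a::idom fps"
  assumes f0: "\<And>m. fps_nth (f m) 0 = 1"
    and fk: "\<And>m k. 0 < k \<Longrightarrow> k < m \<Longrightarrow> fps_nth (f m) k = 0"
  shows "convergent_prod f"
proof -
  define P where "P n = (\<Prod>i\<le>n. f i)" for n
  define L where "L = Abs_fps (\<lambda>k. fps_nth (P k) k)"
  have step: "fps_nth (P (Suc n)) k = fps_nth (P n) k" if "k \<le> n" for n k
  proof -
    have "fps_nth (P (Suc n)) k = (\<Sum>i=0..k. fps_nth (P n) i * fps_nth (f (Suc n)) (k - i))"
      by (simp add: P_def fps_mult_nth)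
    also have "\<dots> = (\<Sum>i=0..k. if i = k then fps_nth (P n) i else 0)"
      using that by (intro sum.cong) (auto simp: f0 fk)
    finally show ?thesis by simp
  qed
  have stable: "fps_nth (P n) k = fps_nth (P k) k" if "k \<le> n" for n k
    using that by (induction rule: dec_induct) (auto simp: step)
  have "P \<longlonglongrightarrow> L"
  proof (rule tendsto_fpsI)
    fix k
    show "\<forall>\<^sub>F n in sequentially. fps_nth (P n) k = fps_nth L k"
      using eventually_ge_at_top[of k] by eventually_elim (metis L_def fps_nth_Abs_fps stable)
  qed
  moreover have "fps_nth L 0 = 1"
    unfolding L_def P_def by (simp add: f0)
  then have "L \<noteq> 0" by auto
  ultimately have "raw_has_prod f 0 L"
    by (simp add: raw_has_prod_def P_def[abs_def])
  then show ?thesis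
    by (auto simp: convergent_prod_def)
qed

lemma convergent_num_factor: "convergent_prod num_factor"
  by (rule convergent_prod_fps) (auto simp: num_factor_def fps_X_power_nth)

lemma convergent_den_factor: "convergent_prod den_factor"
  by (rule convergent_prod_fps) (auto simp: den_factor_def fps_X_power_nth)

end

theory Submission
  imports Defs
begin

text \<open>Let \<open>\<theta>(c, d)\<close> be the series \<open>\<Sum> (-1)\<^sup>k X^(c k\<^sup>2 + d k)\<close> over all integers \<open>k\<close>, so that
  \<open>\<theta>(1, 0) = \<phi>(-X)\<close> and \<open>\<theta>(5, 0) = \<phi>(-X\<^sup>5)\<close> in Ramanujan's notation. Inclusion-exclusion turns twice the
  left-hand side, multiplied by \<open>X\<close>, into the partition generating function times
  \<open>\<theta>(5, 0) - \<theta>(1, 0)\<close>. With \<open>g = \<theta>(10, 6)\<close> and \<open>h = \<theta>(10, 2)\<close>, a ternary lattice identity gives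
  \<open>\<theta>(5, 0) g h = \<theta>(5, 4) h\<^sup>2 + X \<theta>(5, 2) g\<^sup>2\<close>, and counting Gaussian integers modulo \<open>2 - \<i>\<close> gives
  \<open>\<theta>(1, 0)\<^sup>2 = \<theta>(5, 0)\<^sup>2 - 4 X \<theta>(5, 4) \<theta>(5, 2)\<close>. Hence \<open>\<theta>(1, 0) g h\<close> is the difference of the same two
  summands, so that \<open>(\<theta>(5, 0) - \<theta>(1, 0)) h = 2 X \<theta>(5, 2) g\<close>. The Jacobi triple product writes the
  remaining theta series as products over residue classes modulo 40.\<close>

subsection \<open>Power series modulo powers of the variable\<close>

text \<open>Congruence modulo X^(n+1). Identities between infinite products are reduced to finite
  ones by comparing truncations for every \<open>n\<close>.\<close>

definition fps_eq_upto :: "nat \<Rightarrow> 'a::comm_ring_1 fps \<Rightarrow> 'a fps \<Rightarrow> bool" where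
  "fps_eq_upto n f g \<longleftrightarrow> (\<forall>k\<le>n. fps_nth f k = fps_nth g k)"

lemma fps_eq_upto_refl [simp]: "fps_eq_upto n f f"
  by (simp add: fps_eq_upto_def)

lemma fps_eq_upto_sym: "fps_eq_upto n f g \<Longrightarrow> fps_eq_upto n g f"
  by (simp add: fps_eq_upto_def)

lemma fps_eq_upto_trans [trans]: "fps_eq_upto n f g \<Longrightarrow> fps_eq_upto n g h \<Longrightarrow> fps_eq_upto n f h"
  by (simp add: fps_eq_upto_def)

lemma fps_eq_upto_imp_eq: "(\<And>n. fps_eq_upto n f g) \<Longrightarrow> f = g"
  by (auto simp: fps_eq_upto_def fps_eq_iff)

lemma fps_eq_upto_mult:
  "fps_eq_upto n f f' \<Longrightarrow> fps_eq_upto n g g' \<Longrightarrow> fps_eq_upto n (f * g) (f' * g')"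
  by (auto simp: fps_eq_upto_def fps_mult_nth intro!: sum.cong)

text \<open>A factor X^k raises the precision by \<open>k\<close>; this repairs the precision lost
  in the outer terms of the triple product.\<close>

lemma fps_eq_upto_X_power_mult:
  assumes "fps_eq_upto m f g" "n \<le> m + k"
  shows "fps_eq_upto n (fps_X ^ k * f) (fps_X ^ k * g)"
  using assms by (auto simp: fps_eq_upto_def fps_X_power_mult_nth)

lemma fps_eq_upto_prod_1:
  assumes "\<And>i. i \<in> I \<Longrightarrow> fps_eq_upto n (f i) 1"
  shows "fps_eq_upto n (prod f I) 1"
  using assms
proof (induction I rule: infinite_finite_induct)
  case (insert i I)
  then have "fps_eq_upto n (f i * prod f I) (1 * 1)"
    by (intro fps_eq_upto_mult) auto
  with insert show ?case by simp
qed auto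

lemma fps_eq_upto_prodinf:
  fixes f :: "nat \<Rightarrow> 'a::idom fps"
  assumes f0: "\<And>m. fps_nth (f m) 0 = 1"
    and fk: "\<And>m k. 0 < k \<Longrightarrow> k < m \<Longrightarrow> fps_nth (f m) k = 0"
  shows "fps_eq_upto n (\<Prod>m. f m) (\<Prod>m\<le>n. f m)"
proof -
  define L where "L = Abs_fps (\<lambda>k. fps_nth (\<Prod>i\<le>k. f i) k)"
  have one: "fps_eq_upto k (f m) 1" if "k < m" for k m
    using that f0 fk by (auto simp: fps_eq_upto_def)
  have stable: "fps_eq_upto k (\<Prod>i\<le>n. f i) (\<Prod>i\<le>k. f i)" if "k \<le> n" for n k
    using that
  proof (induction rule: dec_induct)
    case (step n)
    then have "fps_eq_upto k ((\<Prod>i\<le>n. f i) * f (Suc n)) ((\<Prod>i\<le>k. f i) * 1)"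
      by (intro fps_eq_upto_mult one) auto
    then show ?case by simp
  qed simp
  have "(\<lambda>n. \<Prod>i\<le>n. f i) \<longlonglongrightarrow> L"
  proof (rule tendsto_fpsI)
    fix k
    show "\<forall>\<^sub>F n in sequentially. fps_nth (\<Prod>i\<le>n. f i) k = fps_nth L k"
      using eventually_ge_at_top[of k]
      by eventually_elim (use stable in \<open>auto simp: L_def fps_eq_upto_def\<close>)
  qed
  \<comment> \<open>\<open>raw_has_prod\<close> demands a nonzero limit, which the constant
    coefficient guarantees.\<close>
  moreover have "fps_nth L 0 = 1"
    unfolding L_def by (simp add: f0)
  then have "L \<noteq> 0" by auto
  ultimately have "raw_has_prod f 0 L"
    by (simp add: raw_has_prod_def)
  then have "f has_prod L"
    by (simp add: has_prod_def)
  then have "prodinf f = L"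
    by (metis has_prod_unique)
  then show ?thesis
    using stable by (auto simp: L_def fps_eq_upto_def)
qed

section \<open>Euler products over sets of exponents\<close>

text \<open>The exponent 0 is skipped, so that whole residue classes may serve as \<open>S\<close>
  and sets sharing only 0 count as disjoint.\<close>

definition fps_prod :: "nat set \<Rightarrow> rat fps" where
  "fps_prod S = (\<Prod>m. if 1 \<le> m \<and> m \<in> S then 1 - fps_X ^ m else 1)"

lemma one_minus_X_power_eq_upto: "n < m \<Longrightarrow> fps_eq_upto n (1 - fps_X ^ m) 1"
  by (auto simp: fps_eq_upto_def fps_X_power_nth)

text \<open>Factors with exponent above \<open>n\<close> are 1 modulo X^(n+1), so \<open>T\<close>
  may overshoot \<open>n\<close>. This admits truncations by number of factors and images such as
  doubled sets.\<close>

lemma fps_prod_eq_upto_prod: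
  assumes "finite T" "S \<inter> {1..n} \<subseteq> T" "T \<subseteq> S" "0 \<notin> T"
  shows "fps_eq_upto n (fps_prod S) (\<Prod>m\<in>T. 1 - fps_X ^ m)"
proof -
  have "fps_eq_upto n (fps_prod S) (\<Prod>m\<le>n. if 1 \<le> m \<and> m \<in> S then 1 - fps_X ^ m else 1)"
    unfolding fps_prod_def
    by (rule fps_eq_upto_prodinf) (auto simp: fps_X_power_nth)
  also have "(\<Prod>m\<le>n. if 1 \<le> m \<and> m \<in> S then 1 - fps_X ^ m else 1) =
      (\<Prod>m\<in>T \<inter> {..n}. 1 - fps_X ^ m :: rat fps)"
  proof (rule prod.mono_neutral_cong_right)
    show "\<forall>i\<in>{..n} - T \<inter> {..n}. (if 1 \<le> i \<and> i \<in> S then 1 - fps_X ^ i else 1) = 1"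
      using assms by auto
    show "(if 1 \<le> x \<and> x \<in> S then 1 - fps_X ^ x else 1) = 1 - fps_X ^ x"
      if "x \<in> T \<inter> {..n}" for x
      using that assms by (cases x) auto
  qed auto
  also have "fps_eq_upto n \<dots> (\<Prod>m\<in>T. 1 - fps_X ^ m)"
  proof -
    have "(\<Prod>m\<in>T. 1 - fps_X ^ m :: rat fps) =
        (\<Prod>m\<in>T \<inter> {..n}. 1 - fps_X ^ m) * (\<Prod>m\<in>T - {..n}. 1 - fps_X ^ m)"
      by (rule prod.Int_Diff) (rule assms)
    moreover have "fps_eq_upto n (\<Prod>m\<in>T - {..n}. 1 - fps_X ^ m :: rat fps) 1"
      by (rule fps_eq_upto_prod_1) (auto intro: one_minus_X_power_eq_upto)
    then have "fps_eq_upto n ((\<Prod>m\<in>T \<inter> {..n}. 1 - fps_X ^ m :: rat fps) * (\<Prod>m\<in>T - {..n}. 1 - fps_X ^ m))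
       ((\<Prod>m\<in>T \<inter> {..n}. 1 - fps_X ^ m) * 1)"
      by (intro fps_eq_upto_mult) auto
    ultimately show ?thesis by (simp add: fps_eq_upto_sym)
  qed
  finally show ?thesis .
qed

lemma fps_prod_eq_upto: "fps_eq_upto n (fps_prod S) (\<Prod>m\<in>S \<inter> {1..n}. 1 - fps_X ^ m)"
  by (rule fps_prod_eq_upto_prod) auto

lemma fps_prod_nth_0 [simp]: "fps_nth (fps_prod S) 0 = 1"
  using fps_prod_eq_upto[of 0 S] by (simp add: fps_eq_upto_def)

lemma fps_prod_neq_0 [simp]: "fps_prod S \<noteq> 0"
  using fps_prod_nth_0[of S] by (metis fps_zero_nth zero_neq_one)

lemma fps_prod_Un:
  assumes "S \<inter> T \<subseteq> {0}"
  shows "fps_prod (S \<union> T) = fps_prod S * fps_prod T"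
proof (rule fps_eq_upto_imp_eq)
  fix n
  have "fps_eq_upto n (fps_prod (S \<union> T)) (\<Prod>m\<in>(S \<union> T) \<inter> {1..n}. 1 - fps_X ^ m)"
    by (rule fps_prod_eq_upto)
  also have "(\<Prod>m\<in>(S \<union> T) \<inter> {1..n}. 1 - fps_X ^ m :: rat fps) =
      (\<Prod>m\<in>S \<inter> {1..n}. 1 - fps_X ^ m) * (\<Prod>m\<in>T \<inter> {1..n}. 1 - fps_X ^ m)"
    unfolding Int_Un_distrib2 using assms by (intro prod.union_disjoint) auto
  also have "fps_eq_upto n \<dots> (fps_prod S * fps_prod T)"
    by (intro fps_eq_upto_mult fps_prod_eq_upto fps_eq_upto_sym[OF fps_prod_eq_upto])
  finally show "fps_eq_upto n (fps_prod (S \<union> T)) (fps_prod S * fps_prod T)" .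
qed

lemma prodinf_num_factor_eq_upto:
  "fps_eq_upto n (\<Prod>m. num_factor m) (\<Prod>m\<in>{m. mu_residue m} \<inter> {1..n}. 1 + fps_X ^ m)"
proof -
  have "fps_eq_upto n (\<Prod>m. num_factor m) (\<Prod>m\<le>n. num_factor m)"
    by (rule fps_eq_upto_prodinf) (auto simp: num_factor_def fps_X_power_nth)
  also have "(\<Prod>m\<le>n. num_factor m) = (\<Prod>m\<in>{m. mu_residue m} \<inter> {1..n}. 1 + fps_X ^ m)"
    by (rule prod.mono_neutral_cong_right) (auto simp: num_factor_def)
  finally show ?thesis .
qed

text \<open>Factorwise this is (1 + X^m)(1 - X^m) = 1 - X^(2m); it makes the numerator a quotient of
  Euler products.\<close>

lemma prodinf_num_factor_mult:
  "(\<Prod>m. num_factor m) * fps_prod {m. mu_residue m} = fps_prod ((*) 2 ` {m. mu_residue m})"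
proof (rule fps_eq_upto_imp_eq)
  fix n
  let ?M = "{m. mu_residue m}"
  have difference_square: "(1 + fps_X ^ m) * (1 - fps_X ^ m :: rat fps) = 1 - fps_X ^ (2 * m)" for m
    by (simp only: power_mult mult.commute[of 2] power2_eq_square) (simp only: algebra_simps, simp)
  have "fps_eq_upto n ((\<Prod>m. num_factor m) * fps_prod ?M)
    ((\<Prod>m\<in>?M \<inter> {1..n}. 1 + fps_X ^ m) * (\<Prod>m\<in>?M \<inter> {1..n}. 1 - fps_X ^ m))"
    by (intro fps_eq_upto_mult fps_prod_eq_upto prodinf_num_factor_eq_upto)
  also have "\<dots> = (\<Prod>m\<in>?M \<inter> {1..n}. 1 - fps_X ^ (2 * m))"
    unfolding prod.distrib[symmetric]
    by (intro prod.cong) (simp_all only: difference_square)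
  also have "\<dots> = (\<Prod>m\<in>(*) 2 ` (?M \<inter> {1..n}). 1 - fps_X ^ m)"
    by (subst prod.reindex) (auto simp: inj_on_def)
  also have "fps_eq_upto n \<dots> (fps_prod ((*) 2 ` ?M))"
    by (rule fps_eq_upto_sym, rule fps_prod_eq_upto_prod) auto
  finally show "fps_eq_upto n ((\<Prod>m. num_factor m) * fps_prod ?M) (fps_prod ((*) 2 ` ?M))" .
qed

subsection \<open>Weighted generating functions\<close>

text \<open>Indices of negative weight and infinite fibres (where \<open>sum\<close> is \<open>0\<close>) are silently dropped;
  \<open>fin_weight\<close> excludes both.\<close>

definition wgf :: "'i set \<Rightarrow> ('i \<Rightarrow> int) \<Rightarrow> ('i \<Rightarrow> 'a::comm_ring_1) \<Rightarrow> 'a fps" where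
  "wgf I w s = Abs_fps (\<lambda>n. \<Sum>i | i \<in> I \<and> w i = int n. s i)"

definition fin_weight :: "'i set \<Rightarrow> ('i \<Rightarrow> int) \<Rightarrow> bool" where
  "fin_weight I w \<longleftrightarrow> (\<forall>i\<in>I. 0 \<le> w i) \<and> (\<forall>n. finite {i \<in> I. w i \<le> n})"

lemma wgf_nth [simp]: "fps_nth (wgf I w s) n = (\<Sum>i | i \<in> I \<and> w i = int n. s i)"
  by (simp add: wgf_def)

lemma fin_weight_fibre: "fin_weight I w \<Longrightarrow> finite {i \<in> I. w i = n}"
  unfolding fin_weight_def by (rule finite_subset[of _ "{i \<in> I. w i \<le> n}"]) auto

lemma fin_weight_subset: "fin_weight I w \<Longrightarrow> J \<subseteq> I \<Longrightarrow> fin_weight J w"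
  unfolding fin_weight_def
  by (auto intro: finite_subset[of "{i \<in> J. w i \<le> n}" "{i \<in> I. w i \<le> n}" for n])

lemma fin_weight_Times:
  assumes "fin_weight I v" "fin_weight J w"
  shows "fin_weight (I \<times> J) (\<lambda>(i, j). v i + w j)"
proof -
  have "finite {p \<in> I \<times> J. (case p of (i, j) \<Rightarrow> v i + w j) \<le> n}" for n
  proof (rule finite_subset)
    show "{p \<in> I \<times> J. (case p of (i, j) \<Rightarrow> v i + w j) \<le> n} \<subseteq> {i \<in> I. v i \<le> n} \<times> {j \<in> J. w j \<le> n}"
    proof clarsimp
      fix a b assume "a \<in> I" "b \<in> J" "v a + w b \<le> n"
      moreover from this have "0 \<le> v a" "0 \<le> w b" using assms by (auto simp: fin_weight_def)
      ultimately show "v a \<le> n \<and> w b \<le> n" by linarith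
    qed
  qed (use assms in \<open>auto simp: fin_weight_def\<close>)
  with assms show ?thesis by (auto simp: fin_weight_def)
qed

lemma wgf_cong:
  "I = J \<Longrightarrow> (\<And>i. i \<in> J \<Longrightarrow> v i = w i) \<Longrightarrow> (\<And>i. i \<in> J \<Longrightarrow> s i = t i) \<Longrightarrow> wgf I v s = wgf J w t"
  by (auto simp: fps_eq_iff intro!: sum.cong)

lemma wgf_mult:
  assumes "fin_weight I v" "fin_weight J w"
  shows "wgf I v s * wgf J w t = wgf (I \<times> J) (\<lambda>(i, j). v i + w j) (\<lambda>(i, j). s i * t j)"
proof (rule fps_ext)
  fix n
  let ?F = "\<lambda>k. {i \<in> I. v i = int k} \<times> {j \<in> J. w j = int (n - k)}"
  have "fps_nth (wgf I v s * wgf J w t) n = (\<Sum>k=0..n. \<Sum>(i, j)\<in>?F k. s i * t j)"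
    by (simp add: fps_mult_nth sum_product sum.cartesian_product)
  also have "\<dots> = (\<Sum>(i, j)\<in>(\<Union>k\<in>{0..n}. ?F k). s i * t j)"
    by (rule sum.UNION_disjoint[symmetric])
       (auto intro!: finite_cartesian_product fin_weight_fibre assms)
  \<comment> \<open>Since both weights are nonnegative, \<open>v i\<close> lies between 0 and
    \<open>n\<close>, so splitting by \<open>k = v i\<close> loses no pair.\<close>
  also have "(\<Union>k\<in>{0..n}. ?F k) = {p \<in> I \<times> J. (case p of (i, j) \<Rightarrow> v i + w j) = int n}"
  proof (intro equalityI subsetI)
    fix p assume "p \<in> {p \<in> I \<times> J. (case p of (i, j) \<Rightarrow> v i + w j) = int n}"
    then obtain i j where ij: "p = (i, j)" "i \<in> I" "j \<in> J" "v i + w j = int n" by auto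
    then have "0 \<le> v i" "0 \<le> w j" using assms by (auto simp: fin_weight_def)
    then show "p \<in> (\<Union>k\<in>{0..n}. ?F k)"
      using ij by (intro UN_I[of "nat (v i)"]) auto
  qed auto
  finally show "fps_nth (wgf I v s * wgf J w t) n =
    fps_nth (wgf (I \<times> J) (\<lambda>(i, j). v i + w j) (\<lambda>(i, j). s i * t j)) n" by simp
qed

lemma wgf_reindex:
  assumes "bij_betw h I J"
  shows "wgf J w s = wgf I (w \<circ> h) (s \<circ> h)"
proof (rule fps_ext)
  fix n
  have "bij_betw h {i \<in> I. w (h i) = int n} {j \<in> J. w j = int n}"
    using assms by (auto simp: bij_betw_def inj_on_def)
  from sum.reindex_bij_betw[OF this, of s]
  show "fps_nth (wgf J w s) n = fps_nth (wgf I (w \<circ> h) (s \<circ> h)) n" by simp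
qed

text \<open>Extension by zero coefficients: series over different sublattices can then be added
  vector by vector.\<close>

lemma wgf_restrict:
  assumes "fin_weight I w" "J \<subseteq> I"
  shows "wgf J w s = wgf I w (\<lambda>i. if i \<in> J then s i else 0)"
proof (rule fps_ext)
  fix n
  show "fps_nth (wgf J w s) n = fps_nth (wgf I w (\<lambda>i. if i \<in> J then s i else 0)) n"
    unfolding wgf_nth
    by (rule sum.mono_neutral_cong_left)
       (use assms in \<open>auto intro: fin_weight_fibre\<close>)
qed

lemma wgf_Un:
  assumes "fin_weight (I \<union> J) w" "I \<inter> J = {}"
  shows "wgf (I \<union> J) w s = wgf I w s + wgf J w s"
proof (rule fps_ext)
  fix n
  have "{i \<in> I \<union> J. w i = int n} = {i \<in> I. w i = int n} \<union> {i \<in> J. w i = int n}" by auto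
  moreover have "finite {i \<in> I. w i = int n}" "finite {i \<in> J. w i = int n}"
    using fin_weight_fibre[OF assms(1), of "int n"] by (auto elim: finite_subset[rotated])
  ultimately show "fps_nth (wgf (I \<union> J) w s) n = fps_nth (wgf I w s + wgf J w s) n"
    unfolding wgf_nth fps_add_nth using assms(2) by (subst sum.union_disjoint[symmetric]) auto
qed

lemma wgf_add: "wgf I w s + wgf I w t = wgf I w (\<lambda>i. s i + t i)"
  by (auto simp: fps_eq_iff sum.distrib)

lemma wgf_uminus: "wgf I w (\<lambda>i. - s i) = - wgf I w s"
  by (auto simp: fps_eq_iff sum_negf)

lemma wgf_X_power_mult:
  assumes "\<And>i. i \<in> I \<Longrightarrow> 0 \<le> w i"
  shows "fps_X ^ k * wgf I w s = wgf I (\<lambda>i. w i + int k) s"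
proof (rule fps_ext)
  fix n
  have "{i \<in> I. w i + int k = int n} = (if n < k then {} else {i \<in> I. w i = int (n - k)})"
    using assms by (force simp: of_nat_diff)
  then show "fps_nth (fps_X ^ k * wgf I w s) n = fps_nth (wgf I (\<lambda>i. w i + int k) s) n"
    by (simp add: fps_X_power_mult_nth)
qed

text \<open>Sums out a coordinate that does not affect the weight, as needed for
  inclusion-exclusion.\<close>

lemma wgf_Sigma:
  assumes "fin_weight I w" "\<And>i. i \<in> I \<Longrightarrow> finite (M i)"
  shows "wgf (Sigma I M) (\<lambda>(i, m). w i) (\<lambda>(i, m). s i m) = wgf I w (\<lambda>i. \<Sum>m\<in>M i. s i m)"
proof (rule fps_ext)
  fix n
  have "{p \<in> Sigma I M. (case p of (i, m) \<Rightarrow> w i) = int n} = Sigma {i \<in> I. w i = int n} M"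
    by auto
  then show "fps_nth (wgf (Sigma I M) (\<lambda>(i, m). w i) (\<lambda>(i, m). s i m)) n =
      fps_nth (wgf I w (\<lambda>i. \<Sum>m\<in>M i. s i m)) n"
    using assms by (simp add: sum.Sigma fin_weight_fibre)
qed

subsection \<open>Theta series and the Jacobi triple product\<close>

definition alt_sign :: "int \<Rightarrow> 'a::comm_ring_1" where
  "alt_sign k = (if even k then 1 else -1)"

lemma alt_sign_0 [simp]: "alt_sign 0 = 1"
  by (simp add: alt_sign_def)

lemma alt_sign_plus_1: "alt_sign (k + 1) = - alt_sign k"
  and alt_sign_minus_1: "alt_sign (k - 1) = - alt_sign k"
  by (auto simp: alt_sign_def)

lemma alt_sign_mult: "alt_sign a * alt_sign b = alt_sign (a + b)"
  by (auto simp: alt_sign_def)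

definition theta_exp :: "nat \<Rightarrow> nat \<Rightarrow> int \<Rightarrow> int" where
  "theta_exp c d k = int c * k\<^sup>2 + int d * k"

definition theta :: "nat \<Rightarrow> nat \<Rightarrow> rat fps" where
  "theta c d = wgf UNIV (theta_exp c d) alt_sign"

text \<open>From k^2 \<ge> |k| and c \<ge> d + 1. The bound makes each coefficient of
  \<open>theta\<close> a finite sum and shows that |k| \<le> n suffices modulo X^(n+1).\<close>

lemma theta_exp_ge_abs:
  assumes "d < c"
  shows "\<bar>k\<bar> \<le> theta_exp c d k"
proof -
  have "\<bar>k\<bar> \<le> \<bar>k\<bar> * \<bar>k\<bar>"
    by (cases "k = 0") (auto simp: mult_le_cancel_left1 simp del: abs_mult_self_eq)
  then have "int c * \<bar>k\<bar> \<le> int c * k\<^sup>2"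
    by (intro mult_left_mono) (auto simp: power2_eq_square)
  moreover have "(int d + 1) * \<bar>k\<bar> \<le> int c * \<bar>k\<bar>"
    using assms by (intro mult_right_mono) auto
  moreover have "- (int d * k) \<le> int d * \<bar>k\<bar>"
    using mult_left_mono[of "- k" "\<bar>k\<bar>" "int d"] by simp
  ultimately show ?thesis
    by (simp add: theta_exp_def algebra_simps)
qed

lemma theta_exp_nonneg: "d < c \<Longrightarrow> 0 \<le> theta_exp c d k"
  using theta_exp_ge_abs[of d c k] by simp

lemma fin_weight_theta:
  assumes "d < c"
  shows "fin_weight UNIV (theta_exp c d)"
proof -
  have "{k \<in> UNIV. theta_exp c d k \<le> n} \<subseteq> {-n..n}" for n
  proof
    fix k assume "k \<in> {k \<in> UNIV. theta_exp c d k \<le> n}"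
    with theta_exp_ge_abs[OF assms, of k] have "\<bar>k\<bar> \<le> n" by simp
    then show "k \<in> {-n..n}" by auto
  qed
  then show ?thesis
    using theta_exp_nonneg[OF assms] by (auto simp: fin_weight_def intro: finite_subset)
qed

section \<open>Finite form of the triple product\<close>

definition q_fact :: "nat \<Rightarrow> nat \<Rightarrow> rat fps" where
  "q_fact p n = (\<Prod>i=1..n. 1 - fps_X ^ (p * i))"

text \<open>The reciprocal \<open>1 / (Q; Q)\<^sub>m\<close> with \<open>Q = X\<^sup>p\<close>, which is \<open>0\<close> for \<open>m < 0\<close>.\<close>

definition q_rfact :: "nat \<Rightarrow> int \<Rightarrow> rat fps" where
  "q_rfact p m = (if m < 0 then 0 else inverse (q_fact p (nat m)))"

lemma q_fact_nth_0: "0 < p \<Longrightarrow> fps_nth (q_fact p n) 0 = 1"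
  unfolding q_fact_def by (induction n) (auto simp: fps_X_power_nth)

lemma q_fact_Suc: "q_fact p (Suc n) = q_fact p n * (1 - fps_X ^ (p * Suc n))"
  by (simp add: q_fact_def)

lemma q_fact_mult_rfact: "0 < p \<Longrightarrow> q_fact p n * q_rfact p (int n) = 1"
  by (simp add: q_rfact_def q_fact_nth_0 inverse_mult_eq_1')

text \<open>The recursion of the reciprocals survives at negative \<open>m\<close>: there the
  truncated exponent is 0, so the factor 1 - X^0 vanishes like the left-hand side.\<close>

lemma q_rfact_step:
  assumes "0 < p"
  shows "q_rfact p m = q_rfact p (m + 1) * (1 - fps_X ^ (p * nat (m + 1)))"
proof (cases "m < 0")
  case True
  then show ?thesis by (auto simp: q_rfact_def)
next
  case False
  then obtain n where n: "m = int n" by (metis not_less zero_le_imp_eq_int)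
  let ?y = "1 - fps_X ^ (p * Suc n) :: rat fps"
  have "q_rfact p (int n) = (q_fact p (Suc n) * q_rfact p (int (Suc n))) * q_rfact p (int n)"
    by (simp only: q_fact_mult_rfact[OF assms] mult_1_left)
  also have "\<dots> = (q_fact p n * q_rfact p (int n)) * (q_rfact p (int (Suc n)) * ?y)"
    by (simp only: q_fact_Suc mult_ac)
  also have "\<dots> = q_rfact p (int (Suc n)) * ?y"
    by (simp only: q_fact_mult_rfact[OF assms] mult_1_left)
  finally have "q_rfact p (int n) = q_rfact p (int (Suc n)) * ?y" .
  moreover have "m + 1 = int (Suc n)" using n by simp
  ultimately show ?thesis using n by (simp only: nat_int)
qed

text \<open>With Q = X^(2c), this is (-1)^k X^(c k^2 + d k) times the Gaussian binomial coefficient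
  of 2n over n + k in base Q, divided by (Q; Q) of length 2n.\<close>

definition jtp_term :: "nat \<Rightarrow> nat \<Rightarrow> nat \<Rightarrow> int \<Rightarrow> rat fps" where
  "jtp_term c d n k = alt_sign k * fps_X ^ nat (theta_exp c d k) *
     q_rfact (2 * c) (int n + k) * q_rfact (2 * c) (int n - k)"

lemma jtp_term_eq_0: "int n < \<bar>k\<bar> \<Longrightarrow> jtp_term c d n k = 0"
  by (auto simp: jtp_term_def q_rfact_def)

text \<open>The algebraic core of the recurrence in \<open>n\<close>: after removing the common
  factor \<open>s * Z * R * R'\<close>, an identity in \<open>u\<close>, \<open>v\<close>,
  \<open>w\<close> alone remains.\<close>

lemma jtp_polynomial_identity:
  fixes u v w R R' s Z :: "'a::comm_ring_1"
  shows "(1 - w) * (1 - u * v) * (s * Z * R * R') =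
    (1 + w) * (s * Z * (R * (1 - u)) * (R' * (1 - v)))
    - (- s * Z * (R * (1 - u) * (v - w)) * R')
    - (- s * Z * (R' * (1 - v) * (u - w)) * R)"
proof -
  have "(1 - w) * (1 - u * v) = (1 + w) * (1 - u) * (1 - v) + (1 - u) * (v - w) + (1 - v) * (u - w)"
    by (simp add: algebra_simps)
  then have "(1 - w) * (1 - u * v) * (s * Z * R * R') =
    ((1 + w) * (1 - u) * (1 - v) + (1 - u) * (v - w) + (1 - v) * (u - w)) * (s * Z * R * R')"
    by simp
  also have "\<dots> = (1 + w) * (s * Z * (R * (1 - u)) * (R' * (1 - v)))
    - (- s * Z * (R * (1 - u) * (v - w)) * R')
    - (- s * Z * (R' * (1 - v) * (u - w)) * R)"
    by (simp add: distrib_left distrib_right mult_ac)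
  finally show ?thesis .
qed

text \<open>With Q = X^(2c), put u = Q^(n+k+1), v = Q^(n-k+1), w = Q^(2n+1). All four terms then
  become multiples of the same reciprocals \<open>R\<close> and \<open>R'\<close>. The bound on
  \<open>k\<close> keeps the truncated exponents of \<open>u\<close> and \<open>v\<close>
  exact.\<close>

lemma jtp_term_Suc:
  assumes "d < c" "\<bar>k\<bar> \<le> int n + 1"
  shows "(1 - fps_X ^ (2 * c * (2 * n + 1))) * (1 - fps_X ^ (2 * c * (2 * n + 2))) * jtp_term c d (Suc n) k =
    (1 + fps_X ^ (2 * c * (2 * n + 1))) * jtp_term c d n k
    - fps_X ^ (c + d + 2 * c * n) * jtp_term c d n (k - 1)
    - fps_X ^ (c - d + 2 * c * n) * jtp_term c d n (k + 1)"
proof -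
  define p where "p = 2 * c"
  have p: "0 < p" using assms(1) by (simp add: p_def)
  define u v w :: "rat fps" where "u = fps_X ^ (p * nat (int n + k + 1))"
    and "v = fps_X ^ (p * nat (int n - k + 1))" and "w = fps_X ^ (p * (2 * n + 1))"
  define R R' where "R = q_rfact p (int n + k + 1)" and "R' = q_rfact p (int n - k + 1)"
  define Z where "Z = (fps_X ^ nat (theta_exp c d k) :: rat fps)"
  have uv: "u * v = fps_X ^ (p * (2 * n + 2))"
  proof -
    have "nat (int n + k + 1) + nat (int n - k + 1) = 2 * n + 2" using assms(2) by linarith
    then show ?thesis unfolding u_def v_def power_add[symmetric] add_mult_distrib2[symmetric] by simp
  qed
  have r1: "q_rfact p (int n + k) = R * (1 - u)"
    using q_rfact_step[OF p, of "int n + k"] by (simp add: R_def u_def)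
  have r2: "q_rfact p (int n - k) = R' * (1 - v)"
    using q_rfact_step[OF p, of "int n - k"] by (simp add: R'_def v_def)
  have r3: "v * q_rfact p (int n + k - 1) = R * (1 - u) * (v - w)"
  \<comment> \<open>At \<open>n + k = -1\<close> the exponent \<open>nat (int n + k)\<close> would
    be truncated; there both sides vanish, because \<open>u = 1\<close> and the reciprocal at -2 is
    0. Otherwise v Q^(n+k) = w.\<close>
  proof (cases "int n + k = -1")
    case True
    then show ?thesis by (simp add: q_rfact_def u_def)
  next
    case False
    then have "nat (int n - k + 1) + nat (int n + k) = 2 * n + 1" using assms(2) by linarith
    then have "v * fps_X ^ (p * nat (int n + k)) = w"
      unfolding w_def v_def power_add[symmetric] add_mult_distrib2[symmetric] by simp
    moreover have "v * q_rfact p (int n + k - 1) = R * (1 - u) * (v - v * fps_X ^ (p * nat (int n + k)))"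
      using q_rfact_step[OF p, of "int n + k - 1"] r1 by (simp add: right_diff_distrib mult_ac)
    ultimately show ?thesis by simp
  qed
  have r4: "u * q_rfact p (int n - k - 1) = R' * (1 - v) * (u - w)"
  proof (cases "int n - k = -1")
    case True
    then show ?thesis by (simp add: q_rfact_def v_def)
  next
    case False
    then have "nat (int n + k + 1) + nat (int n - k) = 2 * n + 1" using assms(2) by linarith
    then have "u * fps_X ^ (p * nat (int n - k)) = w"
      unfolding w_def u_def power_add[symmetric] add_mult_distrib2[symmetric] by simp
    moreover have "u * q_rfact p (int n - k - 1) = R' * (1 - v) * (u - u * fps_X ^ (p * nat (int n - k)))"
      using q_rfact_step[OF p, of "int n - k - 1"] r2 by (simp add: right_diff_distrib mult_ac)
    ultimately show ?thesis by simp
  qed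
  \<comment> \<open>Shifting \<open>k\<close> by one changes the theta exponent by a term linear in
    \<open>k\<close>; the prefactor turns that change into exactly \<open>v\<close> here and
    \<open>u\<close> in the next step.\<close>
  have e1: "fps_X ^ (c + d + p * n) * fps_X ^ nat (theta_exp c d (k - 1)) = Z * v"
  proof -
    have "int (c + d + p * n) + theta_exp c d (k - 1) = theta_exp c d k + int p * (int n - k + 1)"
      by (simp add: theta_exp_def p_def algebra_simps power2_eq_square)
    then have "int (c + d + p * n + nat (theta_exp c d (k - 1))) = int (nat (theta_exp c d k) + p * nat (int n - k + 1))"
      using theta_exp_nonneg[OF assms(1), of k] theta_exp_nonneg[OF assms(1), of "k - 1"] assms(2) by simp
    then show ?thesis unfolding Z_def v_def power_add[symmetric] by (simp only: of_nat_eq_iff)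
  qed
  have e2: "fps_X ^ (c - d + p * n) * fps_X ^ nat (theta_exp c d (k + 1)) = Z * u"
  proof -
    have "int (c - d + p * n) + theta_exp c d (k + 1) = theta_exp c d k + int p * (int n + k + 1)"
      using assms(1) by (simp add: theta_exp_def p_def algebra_simps power2_eq_square of_nat_diff)
    then have "int (c - d + p * n + nat (theta_exp c d (k + 1))) = int (nat (theta_exp c d k) + p * nat (int n + k + 1))"
      using theta_exp_nonneg[OF assms(1), of k] theta_exp_nonneg[OF assms(1), of "k + 1"] assms(2) by simp
    then show ?thesis unfolding Z_def u_def power_add[symmetric] by (simp only: of_nat_eq_iff)
  qed
  let ?s = "alt_sign k :: rat fps"
  have t0: "jtp_term c d (Suc n) k = ?s * Z * R * R'"
    by (simp add: jtp_term_def Z_def R_def R'_def p_def algebra_simps)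
  have t1: "jtp_term c d n k = ?s * Z * (R * (1 - u)) * (R' * (1 - v))"
    unfolding r1[symmetric] r2[symmetric] by (simp add: jtp_term_def Z_def p_def)
  have "fps_X ^ (c + d + p * n) * jtp_term c d n (k - 1) =
      - ?s * (fps_X ^ (c + d + p * n) * fps_X ^ nat (theta_exp c d (k - 1)))
        * q_rfact p (int n + k - 1) * R'"
    unfolding jtp_term_def alt_sign_minus_1 R'_def p_def by (simp add: algebra_simps)
  also have "\<dots> = - ?s * Z * (v * q_rfact p (int n + k - 1)) * R'"
    unfolding e1 by (simp add: algebra_simps)
  finally have t2: "fps_X ^ (c + d + p * n) * jtp_term c d n (k - 1) =
    - ?s * Z * (R * (1 - u) * (v - w)) * R'" unfolding r3 .
  have "fps_X ^ (c - d + p * n) * jtp_term c d n (k + 1) =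
      - ?s * (fps_X ^ (c - d + p * n) * fps_X ^ nat (theta_exp c d (k + 1)))
        * q_rfact p (int n - k - 1) * R"
    unfolding jtp_term_def alt_sign_plus_1 R_def p_def by (simp add: algebra_simps)
  also have "\<dots> = - ?s * Z * (u * q_rfact p (int n - k - 1)) * R"
    unfolding e2 by (simp add: algebra_simps)
  finally have t3: "fps_X ^ (c - d + p * n) * jtp_term c d n (k + 1) =
    - ?s * Z * (R' * (1 - v) * (u - w)) * R" unfolding r4 .
  have "(1 - w) * (1 - u * v) * (?s * Z * R * R') =
    (1 + w) * (?s * Z * (R * (1 - u)) * (R' * (1 - v)))
    - (- ?s * Z * (R * (1 - u) * (v - w)) * R')
    - (- ?s * Z * (R' * (1 - v) * (u - w)) * R)"
    by (rule jtp_polynomial_identity)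
  then show ?thesis
    unfolding p_def[symmetric] t0 t1 t2 t3 w_def[symmetric] uv[symmetric] .
qed

text \<open>The wider range has a margin of one on each side, so it still covers the support after
  the shift.\<close>

lemma sum_shift_int:
  fixes f :: "int \<Rightarrow> 'a::comm_monoid_add"
  assumes "\<And>k. N < \<bar>k\<bar> \<Longrightarrow> f k = 0" "N < M" "\<bar>j\<bar> \<le> 1"
  shows "(\<Sum>k=-M..M. f (k + j)) = (\<Sum>k=-N..N. f k)"
proof -
  have "(\<Sum>k=-M..M. f (k + j)) = (\<Sum>k=-M+j..M+j. f k)"
    by (rule sum.reindex_bij_witness[of _ "\<lambda>k. k - j" "\<lambda>k. k + j"]) auto
  also have "\<dots> = (\<Sum>k=-N..N. f k)"
  proof (rule sum.mono_neutral_right)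
    show "{-N..N} \<subseteq> {-M+j..M+j}" using assms(2,3) by (auto simp: abs_le_iff)
    show "\<forall>i\<in>{-M+j..M+j} - {-N..N}. f i = 0"
    proof
      fix i assume "i \<in> {-M+j..M+j} - {-N..N}"
      then have "N < \<bar>i\<bar>" by auto
      then show "f i = 0" by (rule assms(1))
    qed
  qed simp
  finally show ?thesis .
qed

text \<open>Summed over \<open>k\<close>, the recurrence for the terms multiplies the sum by the two
  new factors of the product.\<close>

lemma finite_jacobi_triple_product:
  assumes "d < c"
  shows "(\<Sum>k=-int n..int n. jtp_term c d n k) * q_fact (2 * c) (2 * n) =
    (\<Prod>j<n. (1 - fps_X ^ (c + d + 2 * c * j)) * (1 - fps_X ^ (c - d + 2 * c * j)))"
proof (induction n)
  case 0
  show ?case by (simp add: jtp_term_def q_rfact_def q_fact_def theta_exp_def)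
next
  case (Suc n)
  define S where "S n = (\<Sum>k=-int n..int n. jtp_term c d n k)" for n
  define w1 w2 a b :: "rat fps" where "w1 = fps_X ^ (2 * c * (2 * n + 1))"
    and "w2 = fps_X ^ (2 * c * (2 * n + 2))"
    and "a = fps_X ^ (c + d + 2 * c * n)" and "b = fps_X ^ (c - d + 2 * c * n)"
  have shift: "(\<Sum>k=-int (Suc n)..int (Suc n). jtp_term c d n (k + j)) = S n" if "\<bar>j\<bar> \<le> 1" for j
    unfolding S_def by (rule sum_shift_int) (use that jtp_term_eq_0 in auto)
  have "(1 - w1) * (1 - w2) * S (Suc n) =
    (\<Sum>k=-int (Suc n)..int (Suc n). (1 + w1) * jtp_term c d n k
      - a * jtp_term c d n (k - 1) - b * jtp_term c d n (k + 1))"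
    unfolding S_def sum_distrib_left w1_def w2_def a_def b_def
    by (intro sum.cong refl jtp_term_Suc assms) auto
  also have "\<dots> = (1 + w1) * S n - a * S n - b * S n"
    using shift[of 0] shift[of 1] shift[of "-1"]
    by (simp add: sum_subtractf sum_distrib_left[symmetric])
  \<comment> \<open>The point is that 1 + a b - a - b = (1 - a)(1 - b).\<close>
  also have "1 + w1 = 1 + a * b"
  proof -
    have "c + d + 2 * c * n + (c - d + 2 * c * n) = 2 * c * (2 * n + 1)"
      using assms by (simp add: algebra_simps)
    then show ?thesis by (simp only: w1_def a_def b_def power_add[symmetric])
  qed
  finally have *: "(1 - w1) * (1 - w2) * S (Suc n) = (1 - a) * (1 - b) * S n"
    by (simp add: algebra_simps)
  have "q_fact (2 * c) (2 * Suc n) = q_fact (2 * c) (2 * n) * (1 - w1) * (1 - w2)"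
    by (simp add: q_fact_Suc w1_def w2_def)
  then have "S (Suc n) * q_fact (2 * c) (2 * Suc n) =
      ((1 - w1) * (1 - w2) * S (Suc n)) * q_fact (2 * c) (2 * n)"
    by (simp add: mult_ac)
  also have "\<dots> = (S n * q_fact (2 * c) (2 * n)) * ((1 - a) * (1 - b))"
    unfolding * by (simp add: mult_ac)
  also have "S n * q_fact (2 * c) (2 * n) =
      (\<Prod>j<n. (1 - fps_X ^ (c + d + 2 * c * j)) * (1 - fps_X ^ (c - d + 2 * c * j)))"
    using Suc by (simp add: S_def)
  finally show ?case by (simp add: S_def a_def b_def)
qed

section \<open>Passage to the infinite triple product\<close>

text \<open>\<open>a\<close> is the least positive member of its class, with \<open>a = p\<close>
  standing for the zero class, so \<open>a + p * j\<close> lists exactly the positive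
  members.\<close>

lemma fps_prod_residue_eq_upto:
  assumes "0 < a" "a \<le> p" "n \<le> N"
  shows "fps_eq_upto n (fps_prod {m. m mod p = a mod p}) (\<Prod>j<N. 1 - fps_X ^ (a + p * j))"
proof -
  have "(\<Prod>j<N. 1 - fps_X ^ (a + p * j)) = (\<Prod>m\<in>(\<lambda>j. a + p * j) ` {..<N}. 1 - fps_X ^ m :: rat fps)"
    using assms by (subst prod.reindex) (auto simp: inj_on_def)
  moreover have "{m. m mod p = a mod p} \<inter> {1..n} \<subseteq> (\<lambda>j. a + p * j) ` {..<N}"
  proof clarsimp
    fix m assume m: "m mod p = a mod p" "Suc 0 \<le> m" "m \<le> n"
    have "a \<le> m"
    proof (rule ccontr)
      assume "\<not> a \<le> m"
      with m assms show False by (cases "a = p") auto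
    qed
    then have "p dvd m - a" using m(1) by (simp add: mod_eq_dvd_iff_nat)
    then obtain j where "m - a = p * j" by (auto elim: dvdE)
    with \<open>a \<le> m\<close> have j: "m = a + p * j" by simp
    have "1 * j \<le> p * j" using assms by (intro mult_right_mono) auto
    then have "j < N" using j m assms by linarith
    with j show "m \<in> (\<lambda>j. a + p * j) ` {..<N}" by auto
  qed
  ultimately show ?thesis
    using assms by (auto intro!: fps_prod_eq_upto_prod)
qed

lemma q_fact_eq_upto:
  assumes "0 < p" "n \<le> N"
  shows "fps_eq_upto n (fps_prod {m. p dvd m}) (q_fact p N)"
proof -
  have "q_fact p N = (\<Prod>j<N. 1 - fps_X ^ (p + p * j))"
    unfolding q_fact_def by (rule prod.reindex_bij_witness[of _ Suc "\<lambda>j. j - 1"])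
       (auto simp flip: mult_Suc_right)
  then show ?thesis
    using fps_prod_residue_eq_upto[of p p n N] assms by (simp add: dvd_eq_mod_eq_0)
qed

lemma fps_eq_upto_sum:
  "(\<And>i. i \<in> I \<Longrightarrow> fps_eq_upto n (f i) (g i)) \<Longrightarrow> fps_eq_upto n (sum f I) (sum g I)"
  by (auto simp: fps_eq_upto_def fps_sum_nth intro!: sum.cong)

text \<open>Modulo X^(l+1) with l = n - |k|, the q-factorials of lengths 2n, n + k and n - k all
  agree with the infinite product, so everything but the theta term cancels. The missing |k| orders
  come from the power of X, whose exponent is at least |k|.\<close>

lemma jtp_term_eq_upto:
  assumes "d < c" "\<bar>k\<bar> \<le> int n"
  shows "fps_eq_upto n (jtp_term c d n k * q_fact (2 * c) (2 * n) * fps_prod {m. 2 * c dvd m})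
    (alt_sign k * fps_X ^ nat (theta_exp c d k))"
proof -
  define p where "p = 2 * c"
  have p: "0 < p" using assms by (simp add: p_def)
  define E where "E = fps_prod {m. p dvd m}"
  define l where "l = n - nat \<bar>k\<bar>"
  obtain a b where ab: "int n + k = int a" "int n - k = int b" "l \<le> a" "l \<le> b" "a \<le> 2 * n"
    using assms(2) by (intro that[of "nat (int n + k)" "nat (int n - k)"]) (auto simp: l_def)
  have "fps_eq_upto l (q_fact p (2 * n)) (q_fact p a)"
    by (rule fps_eq_upto_trans[OF fps_eq_upto_sym]; rule q_fact_eq_upto) (use p ab in auto)
  then have "fps_eq_upto l (q_fact p (2 * n) * q_rfact p (int a)) (q_fact p a * q_rfact p (int a))"
    by (intro fps_eq_upto_mult) auto
  moreover have "fps_eq_upto l (E * q_rfact p (int b)) (q_fact p b * q_rfact p (int b))"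
    unfolding E_def by (intro fps_eq_upto_mult q_fact_eq_upto) (use p ab in auto)
  ultimately have "fps_eq_upto l ((q_fact p (2 * n) * q_rfact p (int a)) * (E * q_rfact p (int b))) (1 * 1)"
    using p by (intro fps_eq_upto_mult) (simp_all add: q_fact_mult_rfact)
  then have "fps_eq_upto n (fps_X ^ nat (theta_exp c d k) *
      ((q_fact p (2 * n) * q_rfact p (int a)) * (E * q_rfact p (int b))))
      (fps_X ^ nat (theta_exp c d k) * (1 * 1))"
    using theta_exp_ge_abs[OF assms(1), of k] by (intro fps_eq_upto_X_power_mult) (auto simp: l_def)
  then have "fps_eq_upto n (alt_sign k * (fps_X ^ nat (theta_exp c d k) *
      ((q_fact p (2 * n) * q_rfact p (int a)) * (E * q_rfact p (int b)))))
      (alt_sign k * (fps_X ^ nat (theta_exp c d k) * (1 * 1)))"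
    by (rule fps_eq_upto_mult[OF fps_eq_upto_refl])
  then show ?thesis
    unfolding jtp_term_def p_def[symmetric] ab E_def[symmetric] by (simp add: mult_ac)
qed

text \<open>The finite form multiplied by (Q; Q) of infinite length, Q = X^(2c), already agrees with
  both sides modulo X^(n+1). For d > 0 the three residue classes are distinct, so one Euler product
  over their union results.\<close>

theorem jacobi_triple_product:
  assumes "0 < d" "d < c"
  shows "theta c d = fps_prod {m. m mod (2 * c) \<in> {0, c + d, c - d}}"
proof -
  define E where "E = fps_prod {m. 2 * c dvd m}"
  define A where "A = fps_prod {m. m mod (2 * c) = c + d}"
  define B where "B = fps_prod {m. m mod (2 * c) = c - d}"
  have "theta c d = A * B * E"
  proof (rule fps_eq_upto_imp_eq)
    fix n
    have A: "fps_eq_upto n A (\<Prod>j<n. 1 - fps_X ^ (c + d + 2 * c * j))"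
      using fps_prod_residue_eq_upto[of "c + d" "2 * c" n n] assms by (simp add: A_def)
    have B: "fps_eq_upto n B (\<Prod>j<n. 1 - fps_X ^ (c - d + 2 * c * j))"
      using fps_prod_residue_eq_upto[of "c - d" "2 * c" n n] assms by (simp add: B_def)
    have "fps_eq_upto n (theta c d) (\<Sum>k=-int n..int n. alt_sign k * fps_X ^ nat (theta_exp c d k))"
      unfolding fps_eq_upto_def
    proof (intro allI impI)
      fix m assume "m \<le> n"
      have "fps_nth (theta c d) m = (\<Sum>k | theta_exp c d k = int m. alt_sign k)"
        by (simp add: theta_def)
      also have "\<dots> = (\<Sum>k=-int n..int n. if theta_exp c d k = int m then alt_sign k else 0)"
      proof (rule sum.mono_neutral_cong_left)
        show "{k. theta_exp c d k = int m} \<subseteq> {- int n..int n}"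
        proof
          fix k assume "k \<in> {k. theta_exp c d k = int m}"
          then have "\<bar>k\<bar> \<le> int n" using theta_exp_ge_abs[OF assms(2), of k] \<open>m \<le> n\<close> by simp
          then show "k \<in> {- int n..int n}" by auto
        qed
      qed auto
      also have "\<dots> = (\<Sum>k=-int n..int n. fps_nth (alt_sign k * fps_X ^ nat (theta_exp c d k)) m)"
        using theta_exp_nonneg[OF assms(2)]
        by (intro sum.cong) (auto simp: alt_sign_def fps_X_power_nth)
      finally show "fps_nth (theta c d) m =
        fps_nth (\<Sum>k=-int n..int n. alt_sign k * fps_X ^ nat (theta_exp c d k)) m"
        by (simp add: fps_sum_nth)
    qed
    also have "fps_eq_upto n \<dots> (\<Sum>k=-int n..int n. jtp_term c d n k * q_fact (2 * c) (2 * n) * E)"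
      unfolding E_def
      by (rule fps_eq_upto_sum, rule fps_eq_upto_sym, rule jtp_term_eq_upto) (use assms in auto)
    also have "\<dots> = (\<Prod>j<n. 1 - fps_X ^ (c + d + 2 * c * j)) * (\<Prod>j<n. 1 - fps_X ^ (c - d + 2 * c * j)) * E"
      unfolding sum_distrib_right[symmetric] finite_jacobi_triple_product[OF assms(2)] prod.distrib ..
    also have "fps_eq_upto n \<dots> (A * B * E)"
      by (intro fps_eq_upto_mult fps_eq_upto_refl fps_eq_upto_sym[OF A] fps_eq_upto_sym[OF B])
    finally show "fps_eq_upto n (theta c d) (A * B * E)" .
  qed
  also have "\<dots> = fps_prod ({m. m mod (2 * c) = c + d} \<union> {m. m mod (2 * c) = c - d} \<union> {m. 2 * c dvd m})"
  proof -
    have "{m. m mod (2 * c) = c + d} \<inter> {m. m mod (2 * c) = c - d} \<subseteq> {0}"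
      "({m. m mod (2 * c) = c + d} \<union> {m. m mod (2 * c) = c - d}) \<inter> {m. 2 * c dvd m} \<subseteq> {0}"
      using assms by (auto simp: dvd_eq_mod_eq_0)
    then show ?thesis by (simp only: A_def B_def E_def fps_prod_Un)
  qed
  also have "{m. m mod (2 * c) = c + d} \<union> {m. m mod (2 * c) = c - d} \<union> {m. 2 * c dvd m} =
      {m. m mod (2 * c) \<in> {0, c + d, c - d}}"
    by (auto simp: dvd_eq_mod_eq_0)
  finally show ?thesis .
qed

subsection \<open>Two identities between binary and ternary theta series\<close>

lemma theta_mult:
  assumes "d < c" "d' < c'"
  shows "theta c d * theta c' d' =
    wgf UNIV (\<lambda>(x, y). theta_exp c d x + theta_exp c' d' y) (\<lambda>(x, y). alt_sign (x + y))"
  unfolding theta_def wgf_mult[OF fin_weight_theta[OF assms(1)] fin_weight_theta[OF assms(2)]]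
  by (rule wgf_cong) (auto simp: alt_sign_mult)

lemma fin_weight_theta2:
  "d < c \<Longrightarrow> d' < c' \<Longrightarrow> fin_weight UNIV (\<lambda>(x, y). theta_exp c d x + theta_exp c' d' y)"
  using fin_weight_Times[OF fin_weight_theta fin_weight_theta, of d c d' c'] by simp

lemma fin_weight_theta3:
  assumes "d < c" "d' < c'" "d'' < c''"
  shows "fin_weight UNIV (\<lambda>(x, y, z). theta_exp c d x + theta_exp c' d' y + theta_exp c'' d'' z)"
  using fin_weight_Times[OF fin_weight_theta[OF assms(1)] fin_weight_theta2[OF assms(2,3)]]
  by (simp add: case_prod_unfold add.assoc)

lemma theta_mult3:
  assumes "d < c" "d' < c'" "d'' < c''"
  shows "theta c d * (theta c' d' * theta c'' d'') =
    wgf UNIV (\<lambda>(x, y, z). theta_exp c d x + theta_exp c' d' y + theta_exp c'' d'' z)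
      (\<lambda>(x, y, z). alt_sign (x + y + z))"
  unfolding theta_mult[OF assms(2,3)] theta_def[of c d]
    wgf_mult[OF fin_weight_theta[OF assms(1)] fin_weight_theta2[OF assms(2,3)]]
  by (rule wgf_cong) (auto simp: alt_sign_mult add.assoc)

text \<open>After completing squares all three products run over the vectors of \<open>\<int>\<^sup>3\<close> congruent to
  \<open>(0, 2, 1)\<close> modulo 5, weighted by their norm and with signs depending only on parities; the
  identity then holds for each vector separately.\<close>

lemma ternary_theta_identity:
  "theta 5 0 * (theta 10 6 * theta 10 2) =
    theta 5 4 * (theta 10 2 * theta 10 2) + fps_X * (theta 5 2 * (theta 10 6 * theta 10 6))"
proof -
  define w :: "int \<times> int \<times> int \<Rightarrow> int"
    where "w = (\<lambda>(p, q, r). theta_exp 5 0 p + theta_exp 5 4 q + theta_exp 5 2 r)"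
  have w: "fin_weight UNIV w"
    unfolding w_def by (rule fin_weight_theta3) auto
  define f1 f2 f3 :: "int \<times> int \<times> int \<Rightarrow> rat"
    where "f1 = (\<lambda>(p, q, r). if even (q + r) then alt_sign (p + q) else 0)"
      and "f2 = (\<lambda>(p, q, r). if even (p + r) then alt_sign (q + r) else 0)"
      and "f3 = (\<lambda>(p, q, r). if odd (p + q) then - alt_sign (q + r) else 0)"
  have "theta 5 0 * (theta 10 6 * theta 10 2) = wgf UNIV w f1"
  proof -
    \<comment> \<open>Found from 5 (b + c)^2 + 5 (b - c)^2 = 10 b^2 + 10 c^2 and 4 (b + c) + 2 (b -
      c) = 6 b + 2 c.\<close>
    let ?h = "\<lambda>(a, b, c). (a, b + c, b - c) :: int \<times> int \<times> int"
    let ?J = "{(p, q, r). even (q + r)} :: (int \<times> int \<times> int) set"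
    have bij: "bij_betw ?h UNIV ?J"
      by (rule bij_betw_byWitness[of _ "\<lambda>(p, q, r). (p, (q + r) div 2, (q - r) div 2)"]) (auto, presburger+)
    have "wgf UNIV w f1 = wgf ?J w (\<lambda>(p, q, r). alt_sign (p + q))"
      unfolding wgf_restrict[OF w subset_UNIV[of ?J]] by (rule wgf_cong) (auto simp: f1_def split: if_splits)
    also have "\<dots> = theta 5 0 * (theta 10 6 * theta 10 2)"
      unfolding wgf_reindex[OF bij] theta_mult3[of 0 5 6 10 2 10, simplified]
      by (rule wgf_cong) (auto simp: w_def theta_exp_def power2_eq_square algebra_simps)
    finally show ?thesis ..
  qed
  moreover have "theta 5 4 * (theta 10 2 * theta 10 2) = wgf UNIV w f2"
  proof -
    let ?h = "\<lambda>(a, b, c). (b - c, a, b + c) :: int \<times> int \<times> int"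
    let ?J = "{(p, q, r). even (p + r)} :: (int \<times> int \<times> int) set"
    have bij: "bij_betw ?h UNIV ?J"
      by (rule bij_betw_byWitness[of _ "\<lambda>(p, q, r). (q, (r + p) div 2, (r - p) div 2)"]) (auto, presburger+)
    have "wgf UNIV w f2 = wgf ?J w (\<lambda>(p, q, r). alt_sign (q + r))"
      unfolding wgf_restrict[OF w subset_UNIV[of ?J]] by (rule wgf_cong) (auto simp: f2_def split: if_splits)
    also have "\<dots> = theta 5 4 * (theta 10 2 * theta 10 2)"
      unfolding wgf_reindex[OF bij] theta_mult3[of 4 5 2 10 2 10, simplified]
      by (rule wgf_cong) (auto simp: w_def theta_exp_def power2_eq_square algebra_simps)
    finally show ?thesis ..
  qed
  moreover have "fps_X * (theta 5 2 * (theta 10 6 * theta 10 6)) = wgf UNIV w f3"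
  proof -
    \<comment> \<open>With s = b + c, the second coordinate contributes 5 (s + 1)^2 - 4 (s + 1) = 5
      s^2 + 6 s + 1: the 1 is the factor \<open>fps_X\<close>, and the shift in parity is the minus
      sign in \<open>f3\<close>.\<close>
    let ?h = "\<lambda>(a, b, c). (b - c, - (b + c) - 1, a) :: int \<times> int \<times> int"
    let ?J = "{(p, q, r). odd (p + q)} :: (int \<times> int \<times> int) set"
    have bij: "bij_betw ?h UNIV ?J"
      by (rule bij_betw_byWitness[of _ "\<lambda>(p, q, r). (r, (p - q - 1) div 2, (- p - q - 1) div 2)"]) (auto, presburger+)
    have *: "fps_X * (theta 5 2 * (theta 10 6 * theta 10 6)) =
      wgf UNIV (\<lambda>i. (case i of (x, y, z) \<Rightarrow> theta_exp 5 2 x + theta_exp 10 6 y + theta_exp 10 6 z) + int 1)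
        (\<lambda>(x, y, z). alt_sign (x + y + z))"
      unfolding theta_mult3[of 2 5 6 10 6 10, simplified]
      using fin_weight_theta3[of 2 5 6 10 6 10]
      by (subst wgf_X_power_mult[symmetric]) (auto simp: fin_weight_def)
    have "wgf UNIV w f3 = wgf ?J w (\<lambda>(p, q, r). - alt_sign (q + r))"
      unfolding wgf_restrict[OF w subset_UNIV[of ?J]] by (rule wgf_cong) (auto simp: f3_def split: if_splits)
    also have "\<dots> = fps_X * (theta 5 2 * (theta 10 6 * theta 10 6))"
      unfolding wgf_reindex[OF bij] *
      by (rule wgf_cong) (auto simp: w_def theta_exp_def power2_eq_square algebra_simps alt_sign_def)
    finally show ?thesis ..
  qed
  moreover have "f1 i = f2 i + f3 i" for i
    by (cases i) (auto simp: f1_def f2_def f3_def alt_sign_def)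
  then have "f1 = (\<lambda>i. f2 i + f3 i)" by (rule ext)
  ultimately show ?thesis by (simp only: wgf_add)
qed

text \<open>The Gaussian integers outside the ideal \<open>(2 - \<i>)\<close> form four cosets, which multiplication
  by \<open>\<i>\<close> permutes cyclically.\<close>

lemma binary_theta_identity:
  "theta 1 0 * theta 1 0 = theta 5 0 * theta 5 0 - 4 * (fps_X * (theta 5 4 * theta 5 2))"
proof -
  define w :: "int \<times> int \<Rightarrow> int" where "w = (\<lambda>(x, y). theta_exp 1 0 x + theta_exp 1 0 y)"
  define s :: "int \<times> int \<Rightarrow> rat" where "s = (\<lambda>(x, y). alt_sign (x + y))"
  \<comment> \<open>The imaginary unit is congruent to 2 modulo the ideal, so \<open>C j\<close> is
    the coset of \<open>j\<close>.\<close>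
  define C :: "int \<Rightarrow> (int \<times> int) set" where "C j = {(x, y). (x + 2 * y) mod 5 = j}" for j
  have w: "fin_weight UNIV w"
    unfolding w_def by (rule fin_weight_theta2) auto
  then have fin: "fin_weight S w" for S
    by (rule fin_weight_subset) simp
  \<comment> \<open>Multiplication by the imaginary unit preserves the norm and the parity of x + y,
    and it doubles the class: 1, 2, 4, 3.\<close>
  have rotate: "wgf (C j) w s = wgf (C i) w s"
    if "bij_betw (\<lambda>(x, y). (- y, x)) (C i) (C j)" for i j
    unfolding wgf_reindex[OF that]
    by (rule wgf_cong) (auto simp: w_def s_def theta_exp_def power2_eq_square alt_sign_def)
  have bij: "bij_betw (\<lambda>(x, y). (- y, x)) (C i) (C j)"
    if "\<And>x y. (x + 2 * y) mod 5 = i \<longleftrightarrow> (2 * x - y) mod 5 = j" for i j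
    by (rule bij_betw_byWitness[of _ "\<lambda>(x, y). (y, - x)"])
       (use that in \<open>auto simp: C_def algebra_simps\<close>)
  have "bij_betw (\<lambda>(x, y). (- y, x)) (C 1) (C 2)" by (rule bij) presburger
  moreover have "bij_betw (\<lambda>(x, y). (- y, x)) (C 2) (C 4)" by (rule bij) presburger
  moreover have "bij_betw (\<lambda>(x, y). (- y, x)) (C 4) (C 3)" by (rule bij) presburger
  ultimately have rotations: "wgf (C 2) w s = wgf (C 1) w s" "wgf (C 4) w s = wgf (C 2) w s"
    "wgf (C 3) w s = wgf (C 4) w s"
    by (auto intro: rotate)
  have "UNIV = C 0 \<union> (C 1 \<union> (C 2 \<union> (C 3 \<union> C 4)))"
    unfolding C_def by (auto; presburger)
  then have "wgf UNIV w s = wgf (C 0 \<union> (C 1 \<union> (C 2 \<union> (C 3 \<union> C 4)))) w s" by simp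
  also have "\<dots> = wgf (C 0) w s + (wgf (C 1) w s + (wgf (C 2) w s + (wgf (C 3) w s + wgf (C 4) w s)))"
    by (subst wgf_Un, rule fin, force simp: C_def)+ simp
  also have "\<dots> = wgf (C 0) w s + 4 * wgf (C 1) w s"
    by (simp add: rotations)
  also have "wgf (C 0) w s = theta 5 0 * theta 5 0"
  proof -
    \<comment> \<open>Multiplication of \<open>m + i n\<close> by \<open>2 - i\<close>, which scales
      the norm by 5.\<close>
    have bij: "bij_betw (\<lambda>(m, n). (2 * m + n, 2 * n - m)) UNIV (C 0)"
    proof (rule bij_betw_imageI)
      show "inj (\<lambda>(m, n). (2 * m + n, 2 * n - m) :: int \<times> int)"
        by (auto simp: inj_on_def)
      have "p \<in> range (\<lambda>(m, n). (2 * m + n, 2 * n - m))" if "p \<in> C 0" for p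
      proof -
        obtain x y where p: "p = (x, y)" by (cases p)
        then have "(x + 2 * y) mod 5 = 0" using that by (simp add: C_def)
        moreover define k where "k = (x + 2 * y) div 5"
        ultimately have "x + 2 * y = 5 * k + 0"
          using mult_div_mod_eq[of 5 "x + 2 * y"] by (simp add: k_def)
        then show ?thesis
          unfolding p by (intro range_eqI[of _ _ "(2 * k - y, k)"]) auto
      qed
      then show "range (\<lambda>(m, n). (2 * m + n, 2 * n - m)) = C 0"
        by (auto simp: C_def; presburger)
    qed
    show ?thesis
      unfolding wgf_reindex[OF bij] theta_mult[of 0 5 0 5, simplified]
      by (rule wgf_cong) (auto simp: w_def s_def theta_exp_def power2_eq_square alt_sign_def algebra_simps)
  qed
  also have "wgf (C 1) w s = - (fps_X * (theta 5 4 * theta 5 2))"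
  proof -
    \<comment> \<open>The same lattice translated by 1: the norm is 5 m^2 + 4 m + 5 n^2 + 2 n + 1,
      and the translation flips the sign.\<close>
    have bij: "bij_betw (\<lambda>(m, n). (1 + 2 * m + n, 2 * n - m)) UNIV (C 1)"
    proof (rule bij_betw_imageI)
      show "inj (\<lambda>(m, n). (1 + 2 * m + n, 2 * n - m) :: int \<times> int)"
        by (auto simp: inj_on_def)
      have "p \<in> range (\<lambda>(m, n). (1 + 2 * m + n, 2 * n - m))" if "p \<in> C 1" for p
      proof -
        obtain x y where p: "p = (x, y)" by (cases p)
        then have "(x + 2 * y) mod 5 = 1" using that by (simp add: C_def)
        moreover define k where "k = (x + 2 * y) div 5"
        ultimately have "x + 2 * y = 5 * k + 1"
          using mult_div_mod_eq[of 5 "x + 2 * y"] by (simp add: k_def)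
        then show ?thesis
          unfolding p by (intro range_eqI[of _ _ "(2 * k - y, k)"]) auto
      qed
      then show "range (\<lambda>(m, n). (1 + 2 * m + n, 2 * n - m)) = C 1"
        by (auto simp: C_def; presburger)
    qed
    have *: "fps_X * (theta 5 4 * theta 5 2) =
      wgf UNIV (\<lambda>i. (case i of (x, y) \<Rightarrow> theta_exp 5 4 x + theta_exp 5 2 y) + int 1)
        (\<lambda>(x, y). alt_sign (x + y))"
      unfolding theta_mult[of 4 5 2 5, simplified]
      using fin_weight_theta2[of 4 5 2 5]
      by (subst wgf_X_power_mult[symmetric]) (auto simp: fin_weight_def)
    show ?thesis
      unfolding wgf_reindex[OF bij] * wgf_uminus[symmetric]
      by (rule wgf_cong) (auto simp: w_def s_def theta_exp_def power2_eq_square alt_sign_def algebra_simps)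
  qed
  finally show ?thesis
    unfolding theta_mult[OF zero_less_one zero_less_one] w_def s_def by simp
qed

lemma theta_nth_0:
  assumes "d < c"
  shows "fps_nth (theta c d) 0 = 1"
proof -
  have "theta_exp c d k = 0 \<longleftrightarrow> k = 0" for k
    using theta_exp_ge_abs[OF assms, of k] by (auto simp: theta_exp_def)
  then have "{k. theta_exp c d k = 0} = {0}" by auto
  then show ?thesis by (simp add: theta_def)
qed

text \<open>The two identities determine the square of \<open>theta 1 0 * theta 10 6 * theta 10 2\<close>, and its
  constant term fixes the sign of the root.\<close>

lemma theta_difference:
  "(theta 5 0 - theta 1 0) * theta 10 2 = 2 * fps_X * (theta 5 2 * theta 10 6)"
proof -
  define a b g h x y :: "rat fps" where "a = theta 1 0" and "b = theta 5 0"
    and "g = theta 10 6" and "h = theta 10 2"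
    and "x = theta 5 4 * (h * h)" and "y = fps_X * (theta 5 2 * (g * g))"
  have b: "b * (g * h) = x + y"
    using ternary_theta_identity by (simp add: b_def g_def h_def x_def y_def)
  \<comment> \<open>This turns the term subtracted in the binary identity into 4 x y, and (x + y)^2
    - 4 x y = (x - y)^2.\<close>
  have xy: "fps_X * (theta 5 4 * theta 5 2) * ((g * h) * (g * h)) = x * y"
    by (simp add: x_def y_def mult_ac)
  have "(a * (g * h)) * (a * (g * h)) = (a * a) * ((g * h) * (g * h))"
    by (simp only: mult_ac)
  also have "a * a = b * b - 4 * (fps_X * (theta 5 4 * theta 5 2))"
    unfolding a_def b_def by (rule binary_theta_identity)
  also have "\<dots> * ((g * h) * (g * h)) = (b * (g * h)) * (b * (g * h)) -
      4 * (fps_X * (theta 5 4 * theta 5 2) * ((g * h) * (g * h)))"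
    by (simp add: algebra_simps)
  also have "\<dots> = (x - y) * (x - y)"
    unfolding b xy by (simp add: algebra_simps)
  finally have "a * (g * h) = x - y \<or> a * (g * h) = - (x - y)"
    by (simp only: square_eq_iff)
  moreover have "a * (g * h) \<noteq> - (x - y)"
  proof
    assume eq: "a * (g * h) = - (x - y)"
    have "fps_nth (a * (g * h)) 0 = 1" "fps_nth (x - y) 0 = 1"
      by (simp_all add: a_def g_def h_def x_def y_def theta_nth_0)
    then show False by (simp only: eq fps_neg_nth)
  qed
  ultimately have a: "a * (g * h) = x - y"
    by blast
  have "g * ((b - a) * h) = b * (g * h) - a * (g * h)"
    by (simp add: algebra_simps)
  also have "\<dots> = g * (2 * fps_X * (theta 5 2 * g))"
    unfolding a b by (simp add: y_def algebra_simps)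
  finally have "g * ((b - a) * h) = g * (2 * fps_X * (theta 5 2 * g))" .
  moreover have "g \<noteq> 0"
    using theta_nth_0[of 6 10] by (auto simp: g_def)
  ultimately show ?thesis
    by (simp add: a_def b_def g_def h_def)
qed

subsection \<open>Generating functions of partitions\<close>

declare of_nat_sum_mset [simp del]

definition parts_in :: "nat set \<Rightarrow> nat multiset set" where
  "parts_in S = {\<pi>. is_partition \<pi> \<and> set_mset \<pi> \<subseteq> S}"

definition partition_fps :: "nat set \<Rightarrow> rat fps" where
  "partition_fps S = wgf (parts_in S) (\<lambda>\<pi>. int (sum_mset \<pi>)) (\<lambda>_. 1)"

definition distinct_partition_fps :: "nat set \<Rightarrow> rat fps" where
  "distinct_partition_fps S = wgf {\<pi> \<in> parts_in S. distinct_parts \<pi>} (\<lambda>\<pi>. int (sum_mset \<pi>)) (\<lambda>_. 1)"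

lemma fin_weight_partitions:
  assumes "J \<subseteq> Collect is_partition"
  shows "fin_weight J (\<lambda>\<pi>. int (sum_mset \<pi>))"
proof -
  have "finite {\<pi> \<in> J. int (sum_mset \<pi>) \<le> n}" for n
    by (rule finite_subset[OF _ finite_partitions_le[of "nat n"]])
       (use assms in \<open>auto\<close>)
  then show ?thesis by (auto simp: fin_weight_def)
qed

lemma parts_in_subset: "parts_in S \<subseteq> Collect is_partition"
  by (auto simp: parts_in_def)

lemma wgf_add_mset:
  assumes "I \<subseteq> Collect is_partition"
  shows "wgf (add_mset m ` I) (\<lambda>\<pi>. int (sum_mset \<pi>)) (\<lambda>_. 1) =
    fps_X ^ m * wgf I (\<lambda>\<pi>. int (sum_mset \<pi>)) (\<lambda>_. 1 :: 'a::comm_ring_1)"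
proof -
  let ?w = "\<lambda>\<pi>. int (sum_mset \<pi>)"
  have "bij_betw (add_mset m) I (add_mset m ` I)"
    by (auto simp: bij_betw_def inj_on_def)
  then have "wgf (add_mset m ` I) ?w (\<lambda>_. 1) = wgf I (?w \<circ> add_mset m) ((\<lambda>_. 1 :: 'a) \<circ> add_mset m)"
    by (rule wgf_reindex)
  also have "\<dots> = wgf I (\<lambda>\<pi>. ?w \<pi> + int m) (\<lambda>_. 1)"
    by (rule wgf_cong) (auto)
  also have "\<dots> = fps_X ^ m * wgf I ?w (\<lambda>_. 1)"
    by (rule wgf_X_power_mult[symmetric]) simp
  finally show ?thesis .
qed

lemma part_le_sum_mset: "x \<in># \<pi> \<Longrightarrow> x \<le> sum_mset \<pi>" for \<pi> :: "nat multiset"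
  using sum_mset.remove[of x \<pi>] by simp

lemma wgf_parts_eq_upto:
  assumes "\<And>\<pi>. is_partition \<pi> \<Longrightarrow> sum_mset \<pi> \<le> n \<Longrightarrow> \<pi> \<in> I \<longleftrightarrow> \<pi> \<in> J"
    and "I \<subseteq> Collect is_partition" "J \<subseteq> Collect is_partition"
  shows "fps_eq_upto n (wgf I (\<lambda>\<pi>. int (sum_mset \<pi>)) s) (wgf J (\<lambda>\<pi>. int (sum_mset \<pi>)) s)"
  unfolding fps_eq_upto_def wgf_nth
proof (intro allI impI sum.cong refl)
  fix k assume "k \<le> n"
  then show "{i \<in> I. int (sum_mset i) = int k} = {i \<in> J. int (sum_mset i) = int k}"
    using assms by (auto)
qed

text \<open>Adding a part size \<open>m\<close>: a partition either avoids \<open>m\<close> or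
  arises by adding one copy of \<open>m\<close> to a partition that may still contain it.\<close>

lemma finite_partition_fps:
  assumes "finite T" "0 \<notin> T"
  shows "partition_fps T * (\<Prod>m\<in>T. 1 - fps_X ^ m) = 1"
  using assms
proof (induction T)
  case empty
  have empty: "parts_in {} = {{#}}"
    by (auto simp: parts_in_def is_partition_def)
  have "{i \<in> parts_in {}. int (sum_mset i) = int n} = (if n = 0 then {{#}} else {})" for n
    unfolding empty by auto
  then show ?case
    by (auto simp: partition_fps_def fps_eq_iff)
next
  case (insert m T)
  let ?w = "\<lambda>\<pi>. int (sum_mset \<pi>)"
  have eq: "parts_in (insert m T) = parts_in T \<union> add_mset m ` parts_in (insert m T)"
  proof (intro equalityI subsetI)
    fix \<pi> assume \<pi>: "\<pi> \<in> parts_in (insert m T)"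
    show "\<pi> \<in> parts_in T \<union> add_mset m ` parts_in (insert m T)"
    proof (cases "m \<in># \<pi>")
      case True
      then obtain \<rho> where "\<pi> = add_mset m \<rho>" by (meson multi_member_split)
      with \<pi> show ?thesis by (auto simp: parts_in_def is_partition_def)
    qed (use \<pi> in \<open>auto simp: parts_in_def\<close>)
  qed (use insert in \<open>auto simp: parts_in_def is_partition_def\<close>)
  have "partition_fps (insert m T) = wgf (parts_in T \<union> add_mset m ` parts_in (insert m T)) ?w (\<lambda>_. 1)"
    using eq by (simp only: partition_fps_def)
  also have "\<dots> = partition_fps T + wgf (add_mset m ` parts_in (insert m T)) ?w (\<lambda>_. 1)"
    unfolding partition_fps_def
  proof (rule wgf_Un)
    show "fin_weight (parts_in T \<union> add_mset m ` parts_in (insert m T)) ?w"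
      unfolding eq[symmetric] by (rule fin_weight_partitions[OF parts_in_subset])
    show "parts_in T \<inter> add_mset m ` parts_in (insert m T) = {}"
      using insert by (auto simp: parts_in_def)
  qed
  also have "wgf (add_mset m ` parts_in (insert m T)) ?w (\<lambda>_. 1) = fps_X ^ m * partition_fps (insert m T)"
    unfolding partition_fps_def by (rule wgf_add_mset[OF parts_in_subset])
  finally have "partition_fps (insert m T) * (1 - fps_X ^ m) = partition_fps T"
    by (simp add: algebra_simps)
  then show ?case
    using insert by (simp add: mult.assoc[symmetric])
qed

text \<open>As for unrestricted multiplicities, except that removing \<open>m\<close> leaves a
  partition without \<open>m\<close>; hence the factor 1 + X^m instead of a geometric
  series.\<close>

lemma finite_distinct_partition_fps:
  assumes "finite T" "0 \<notin> T"
  shows "distinct_partition_fps T = (\<Prod>m\<in>T. 1 + fps_X ^ m)"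
  using assms
proof (induction T)
  case empty
  have empty: "{\<pi> \<in> parts_in {}. distinct_parts \<pi>} = {{#}}"
    by (auto simp: parts_in_def is_partition_def distinct_parts_def)
  have "{i \<in> {\<pi> \<in> parts_in {}. distinct_parts \<pi>}. int (sum_mset i) = int n} = (if n = 0 then {{#}} else {})" for n
    unfolding empty by auto
  then show ?case
    unfolding distinct_partition_fps_def fps_eq_iff wgf_nth by auto
next
  case (insert m T)
  let ?w = "\<lambda>\<pi>. int (sum_mset \<pi>)"
  let ?D = "\<lambda>S. {\<pi> \<in> parts_in S. distinct_parts \<pi>}"
  have D: "?D S \<subseteq> Collect is_partition" for S
    using parts_in_subset by auto
  have eq: "?D (insert m T) = ?D T \<union> add_mset m ` ?D T"
  proof (intro equalityI subsetI)
    fix \<pi> assume \<pi>: "\<pi> \<in> ?D (insert m T)"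
    show "\<pi> \<in> ?D T \<union> add_mset m ` ?D T"
    proof (cases "m \<in># \<pi>")
      case True
      then obtain \<rho> where \<rho>: "\<pi> = add_mset m \<rho>" by (meson multi_member_split)
      have c: "count \<pi> x = 1" if "x \<in># \<pi>" for x
        using \<pi> that by (auto simp: distinct_parts_def)
      have "m \<notin># \<rho>"
        using c[of m] unfolding \<rho> by (simp add: not_in_iff)
      moreover have "count \<rho> x = 1" if "x \<in># \<rho>" for x
        using c[of x] that \<open>m \<notin># \<rho>\<close> unfolding \<rho> by (cases "x = m") auto
      ultimately have "\<rho> \<in> ?D T"
        using \<pi> \<rho> by (auto simp: parts_in_def is_partition_def distinct_parts_def)
      with \<rho> show ?thesis by auto
    qed (use \<pi> in \<open>auto simp: parts_in_def\<close>)
  next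
    fix \<pi> assume "\<pi> \<in> ?D T \<union> add_mset m ` ?D T"
    then show "\<pi> \<in> ?D (insert m T)"
    proof
      assume "\<pi> \<in> add_mset m ` ?D T"
      then obtain \<rho> where \<rho>: "\<pi> = add_mset m \<rho>" "\<rho> \<in> ?D T" by auto
      then have "count \<rho> m = 0"
        using insert by (auto simp: parts_in_def not_in_iff[symmetric])
      with \<rho> insert show ?thesis
        by (auto simp: parts_in_def is_partition_def distinct_parts_def)
    qed (auto simp: parts_in_def)
  qed
  have "distinct_partition_fps (insert m T) = wgf (?D T) ?w (\<lambda>_. 1) + wgf (add_mset m ` ?D T) ?w (\<lambda>_. 1)"
    unfolding distinct_partition_fps_def eq
  proof (rule wgf_Un)
    show "fin_weight (?D T \<union> add_mset m ` ?D T) ?w"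
      unfolding eq[symmetric] by (rule fin_weight_partitions[OF D])
    show "?D T \<inter> add_mset m ` ?D T = {}"
      using insert by (auto simp: parts_in_def)
  qed
  also have "\<dots> = distinct_partition_fps T + fps_X ^ m * distinct_partition_fps T"
    unfolding distinct_partition_fps_def wgf_add_mset[OF D] ..
  finally show ?case
    using insert by (simp add: algebra_simps)
qed

text \<open>Euler's product: a partition of at most \<open>n\<close> only has parts in
  \<open>{1..n}\<close>, so the case of finitely many part sizes settles each truncation.\<close>

lemma partition_fps_mult_fps_prod: "partition_fps S * fps_prod S = 1"
proof (rule fps_eq_upto_imp_eq)
  fix n
  have "fps_eq_upto n (partition_fps S) (partition_fps (S \<inter> {1..n}))"
    unfolding partition_fps_def
  proof (rule wgf_parts_eq_upto)
    fix \<pi> :: "nat multiset" assume \<pi>: "is_partition \<pi>" "sum_mset \<pi> \<le> n"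
    have "x \<in> {1..n}" if "x \<in># \<pi>" for x
      using \<pi> part_le_sum_mset[OF that] that by (auto simp: is_partition_def Suc_le_eq)
    then show "\<pi> \<in> parts_in S \<longleftrightarrow> \<pi> \<in> parts_in (S \<inter> {1..n})"
      by (auto simp: parts_in_def)
  qed (rule parts_in_subset)+
  then have "fps_eq_upto n (partition_fps S * fps_prod S)
      (partition_fps (S \<inter> {1..n}) * (\<Prod>m\<in>S \<inter> {1..n}. 1 - fps_X ^ m))"
    by (intro fps_eq_upto_mult fps_prod_eq_upto)
  then show "fps_eq_upto n (partition_fps S * fps_prod S) 1"
    by (simp add: finite_partition_fps)
qed

lemma distinct_partition_fps_eq: "distinct_partition_fps {m. mu_residue m} = (\<Prod>m. num_factor m)"
proof (rule fps_eq_upto_imp_eq)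
  fix n
  let ?M = "{m. mu_residue m}"
  have "fps_eq_upto n (distinct_partition_fps ?M) (distinct_partition_fps (?M \<inter> {1..n}))"
    unfolding distinct_partition_fps_def
  proof (rule wgf_parts_eq_upto)
    fix \<pi> :: "nat multiset" assume \<pi>: "is_partition \<pi>" "sum_mset \<pi> \<le> n"
    have "x \<in> {1..n}" if "x \<in># \<pi>" for x
      using \<pi> part_le_sum_mset[OF that] that by (auto simp: is_partition_def Suc_le_eq)
    then show "\<pi> \<in> {\<pi> \<in> parts_in ?M. distinct_parts \<pi>} \<longleftrightarrow>
        \<pi> \<in> {\<pi> \<in> parts_in (?M \<inter> {1..n}). distinct_parts \<pi>}"
      by (auto simp: parts_in_def)
  qed (auto simp: parts_in_def)
  also have "distinct_partition_fps (?M \<inter> {1..n}) = (\<Prod>m\<in>?M \<inter> {1..n}. 1 + fps_X ^ m)"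
    by (rule finite_distinct_partition_fps) auto
  also have "fps_eq_upto n \<dots> (\<Prod>m. num_factor m)"
    by (rule fps_eq_upto_sym[OF prodinf_num_factor_eq_upto])
  finally show "fps_eq_upto n (distinct_partition_fps ?M) (\<Prod>m. num_factor m)" .
qed

lemma partition_pairs_fps:
  "Abs_fps (\<lambda>n. of_nat (card (partition_pairs n))) =
    distinct_partition_fps {m. mu_residue m} * partition_fps {m. nu_residue m}"
proof -
  let ?D = "{\<pi> \<in> parts_in {m. mu_residue m}. distinct_parts \<pi>}"
  let ?P = "parts_in {m. nu_residue m}"
  have "{p \<in> ?D \<times> ?P. (case p of (\<mu>, \<nu>) \<Rightarrow> int (sum_mset \<mu>) + int (sum_mset \<nu>)) = int n} =
      partition_pairs n" for n
    by (auto simp: partition_pairs_def parts_in_def simp flip: of_nat_add)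
  moreover have "fin_weight ?D (\<lambda>\<pi>. int (sum_mset \<pi>))" "fin_weight ?P (\<lambda>\<pi>. int (sum_mset \<pi>))"
    by (auto intro!: fin_weight_partitions simp: parts_in_def)
  ultimately show ?thesis
    unfolding distinct_partition_fps_def partition_fps_def
    by (simp add: wgf_mult fps_eq_iff case_prod_unfold)
qed

subsection \<open>Partitions with prescribed minimal excludant\<close>

text \<open>For A > 0, a partition contains this multiset exactly when its minimal excludant is at
  least \<open>a + m * A\<close>.\<close>

definition stair :: "nat \<Rightarrow> nat \<Rightarrow> nat \<Rightarrow> nat multiset" where
  "stair A a m = image_mset (\<lambda>i. a + i * A) (mset_set {..<m})"

lemma sum_stair: "sum_mset (stair A a m) = (\<Sum>i<m. a + i * A)"
  by (simp add: stair_def sum_unfold_sum_mset)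

text \<open>For A > 0 the entries are distinct, so multiset inclusion only asks for
  membership.\<close>

lemma stair_subset_iff:
  assumes "0 < A"
  shows "stair A a m \<subseteq># \<pi> \<longleftrightarrow> (\<forall>i<m. a + i * A \<in># \<pi>)"
proof -
  have "stair A a m = mset_set ((\<lambda>i. a + i * A) ` {..<m})"
    unfolding stair_def by (rule image_mset_mset_set) (use assms in \<open>auto simp: inj_on_def\<close>)
  moreover have "mset_set X \<subseteq># \<pi> \<longleftrightarrow> X \<subseteq> set_mset \<pi>" if "finite X" for X :: "nat set"
    by (metis finite_set_mset_mset_set msubset_mset_set_iff[of X "set_mset \<pi>"] mset_set_set_mset_msubset
        finite_set_mset set_mset_mono subset_mset.order_trans that)
  ultimately show ?thesis by auto
qed

lemma is_partition_stair: "0 < a \<Longrightarrow> is_partition (stair A a m)"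
  by (auto simp: is_partition_def stair_def)

lemma fin_weight_stair:
  assumes "0 < a"
  shows "fin_weight UNIV (\<lambda>m. int (sum_mset (stair A a m)))"
proof -
  have "m \<le> sum_mset (stair A a m)" for m
    using size_le_sum_mset[OF is_partition_stair[OF assms], of A m] by (simp add: stair_def)
  then have "{m \<in> UNIV. int (sum_mset (stair A a m)) \<le> n} \<subseteq> {..nat n}" for n
    by (auto simp: nat_le_iff le_nat_iff intro: order_trans)
       (meson dual_order.trans nat_le_iff of_nat_le_iff nat_le_eq_zle)
  then show ?thesis
    by (auto simp: fin_weight_def intro: finite_subset)
qed

lemma sum_alt_sign: "(\<Sum>m\<le>J. alt_sign (int m)) = (if even J then 1 else 0 :: 'a::comm_ring_1)"
  by (induction J) (auto simp: alt_sign_def)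

text \<open>If the minimal excludant is \<open>a + J * A\<close>, the contained staircases are those
  with m \<le> J. Their signs sum to 1 or 0 according to the parity of \<open>J\<close>, which is
  what the congruence modulo \<open>2 * A\<close> detects.\<close>

lemma sum_alt_sign_stairs:
  assumes "0 < A"
  shows "finite {m. stair A a m \<subseteq># \<pi>}"
    and "(\<Sum>m | stair A a m \<subseteq># \<pi>. alt_sign (int m)) =
      (if [mex A a \<pi> = a] (mod 2 * A) then 1 else 0 :: 'a::comm_ring_1)"
proof -
  obtain J where J: "mex A a \<pi> = a + J * A" "a + J * A \<notin># \<pi>"
    using mex_in_and_notin[OF assms, of a \<pi>] by metis
  have "a + i * A \<in># \<pi>" if "i < J" for i
  proof -
    have "a + i * A < mex A a \<pi>" using that assms J by simp
    from not_less_Least[OF this[unfolded mex_def]] show ?thesis by blast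
  qed
  then have "stair A a m \<subseteq># \<pi> \<longleftrightarrow> m \<le> J" for m
    unfolding stair_subset_iff[OF assms] using J(2) by (meson leI order.strict_trans2)
  then have M: "{m. stair A a m \<subseteq># \<pi>} = {..J}" by auto
  show "finite {m. stair A a m \<subseteq># \<pi>}" unfolding M by simp
  have "[mex A a \<pi> = a] (mod 2 * A) \<longleftrightarrow> even J"
    using assms unfolding J(1) by (simp add: cong_add_lcancel_0_nat cong_0_iff)
  then show "(\<Sum>m | stair A a m \<subseteq># \<pi>. alt_sign (int m)) =
      (if [mex A a \<pi> = a] (mod 2 * A) then 1 else 0 :: 'a)"
    unfolding M sum_alt_sign by simp
qed

text \<open>Inclusion-exclusion over the initial segments of \<open>a, a + A, a + 2 A, \<dots>\<close> contained in a
  partition.\<close>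

lemma pmex_fps:
  assumes "0 < A" "0 < a"
  shows "Abs_fps (\<lambda>n. of_nat (pmex A a (int n))) =
    partition_fps UNIV * wgf UNIV (\<lambda>m. int (sum_mset (stair A a m))) (\<lambda>m. alt_sign (int m))"
proof -
  let ?P = "Collect is_partition"
  let ?w = "\<lambda>\<pi>. int (sum_mset \<pi>)"
  let ?M = "\<lambda>\<pi>. {m. stair A a m \<subseteq># \<pi>}"
  have P: "parts_in UNIV = ?P" by (auto simp: parts_in_def)
  have fin: "fin_weight ?P ?w" by (rule fin_weight_partitions) simp
  \<comment> \<open>Marking a staircase inside a partition amounts to removing it, which makes the
    two weights independent.\<close>
  have bij: "bij_betw (\<lambda>(\<pi>, m). (\<pi> + stair A a m, m)) (?P \<times> UNIV) (Sigma ?P ?M)"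
    by (rule bij_betw_byWitness[of _ "\<lambda>(\<pi>, m). (\<pi> - stair A a m, m)"])
       (use is_partition_stair[OF assms(2)] in \<open>auto simp: is_partition_def, meson in_diffD\<close>)
  have "partition_fps UNIV * wgf UNIV (\<lambda>m. ?w (stair A a m)) (\<lambda>m. alt_sign (int m)) =
    wgf (?P \<times> UNIV) (\<lambda>(\<pi>, m). ?w \<pi> + ?w (stair A a m)) (\<lambda>(\<pi>, m). 1 * alt_sign (int m))"
    unfolding partition_fps_def P by (rule wgf_mult[OF fin fin_weight_stair[OF assms(2)]])
  also have "\<dots> = wgf (Sigma ?P ?M) (\<lambda>(\<pi>, m). ?w \<pi>) (\<lambda>(\<pi>, m). alt_sign (int m))"
    unfolding wgf_reindex[OF bij] by (rule wgf_cong) (auto)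
  also have "\<dots> = wgf ?P ?w (\<lambda>\<pi>. \<Sum>m\<in>?M \<pi>. alt_sign (int m))"
    by (rule wgf_Sigma[OF fin sum_alt_sign_stairs(1)[OF assms(1)]])
  also have "\<dots> = Abs_fps (\<lambda>n. of_nat (pmex A a (int n)))"
  proof (rule fps_ext)
    fix n
    have "finite {\<pi> \<in> ?P. ?w \<pi> = int n}" by (rule fin_weight_fibre[OF fin])
    then show "fps_nth (wgf ?P ?w (\<lambda>\<pi>. \<Sum>m\<in>?M \<pi>. alt_sign (int m))) n =
        fps_nth (Abs_fps (\<lambda>n. of_nat (pmex A a (int n)) :: rat)) n"
      by (simp add: sum_alt_sign_stairs(2)[OF assms(1)] pmex_def sum.If_cases Int_def conj_assoc
         )
  qed
  finally show ?thesis ..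
qed

section \<open>From staircases to theta series\<close>

text \<open>For d = 0 the terms at \<open>k\<close> and \<open>-k\<close> agree. Writing k = m + 1
  flips the sign, whence the minus.\<close>

lemma theta_0_eq:
  assumes "0 < c"
  shows "theta c 0 = 1 - 2 * wgf UNIV (\<lambda>m::nat. int c * (int m + 1)\<^sup>2) (\<lambda>m. alt_sign (int m))"
proof -
  let ?w = "theta_exp c 0"
  let ?U = "wgf UNIV (\<lambda>m::nat. int c * (int m + 1)\<^sup>2) (\<lambda>m. alt_sign (int m)) :: rat fps"
  have fin: "fin_weight S ?w" for S
    by (rule fin_weight_subset[OF fin_weight_theta]) (use assms in auto)
  have "(UNIV :: int set) = {0} \<union> ({0<..} \<union> {..<0})" by auto
  then have "theta c 0 = wgf ({0} \<union> ({0<..} \<union> {..<0})) ?w alt_sign"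
    by (simp add: theta_def)
  also have "\<dots> = wgf {0} ?w alt_sign + (wgf {0<..} ?w alt_sign + wgf {..<0} ?w alt_sign)"
    by (subst wgf_Un, rule fin, force)+ simp
  also have "wgf {0} ?w alt_sign = (1 :: rat fps)"
  proof (rule fps_ext)
    fix n
    have "{i \<in> {0}. ?w i = int n} = (if n = 0 then {0} else {})" by (auto simp: theta_exp_def)
    then show "fps_nth (wgf {0} ?w alt_sign) n = fps_nth (1 :: rat fps) n" by simp
  qed
  also have "wgf {0<..} ?w alt_sign = - ?U"
  proof -
    have bij: "bij_betw (\<lambda>m. int m + 1) UNIV {0<..}"
      by (rule bij_betw_byWitness[of _ "\<lambda>k. nat (k - 1)"]) auto
    show ?thesis
      unfolding wgf_reindex[OF bij] wgf_uminus[symmetric]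
      by (rule wgf_cong) (auto simp: theta_exp_def alt_sign_def)
  qed
  also have "wgf {..<0} ?w alt_sign = - ?U"
  proof -
    have bij: "bij_betw (\<lambda>m. - (int m + 1)) UNIV {..<0}"
      by (rule bij_betw_byWitness[of _ "\<lambda>k. nat (- k - 1)"]) auto
    show ?thesis
      unfolding wgf_reindex[OF bij] wgf_uminus[symmetric]
      by (rule wgf_cong) (auto simp: theta_exp_def alt_sign_def power2_eq_square algebra_simps)
  qed
  finally show ?thesis by simp
qed

text \<open>The odd numbers 3, 5, 7, ... lack only the initial 1 to sum to a square.\<close>

lemma stair_exponent_2_3: "int (sum_mset (stair 2 3 m)) + 1 = (int m + 1)\<^sup>2"
  unfolding sum_stair by (induction m) (auto simp: power2_eq_square algebra_simps)

lemma stair_exponent_10_15: "int (sum_mset (stair 10 15 m)) + 5 = 5 * (int m + 1)\<^sup>2"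
  unfolding sum_stair by (induction m) (auto simp: power2_eq_square algebra_simps)

lemma pmex_2_3_fps:
  "2 * fps_X * Abs_fps (\<lambda>n. of_nat (pmex 2 3 (int n))) = partition_fps UNIV * (1 - theta 1 0)"
proof -
  have "fps_X ^ 1 * wgf UNIV (\<lambda>m. int (sum_mset (stair 2 3 m))) (\<lambda>m. alt_sign (int m) :: rat) =
      wgf UNIV (\<lambda>m. int 1 * (int m + 1)\<^sup>2) (\<lambda>m. alt_sign (int m))"
    by (subst wgf_X_power_mult)
       (auto intro!: wgf_cong simp: stair_exponent_2_3)
  then show ?thesis
    unfolding pmex_fps[of 2 3, simplified] theta_0_eq[OF zero_less_one] by (simp add: mult_ac)
qed

lemma pmex_10_15_fps:
  "2 * fps_X ^ 5 * Abs_fps (\<lambda>n. of_nat (pmex 10 15 (int n))) = partition_fps UNIV * (1 - theta 5 0)"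
proof -
  have "fps_X ^ 5 * wgf UNIV (\<lambda>m. int (sum_mset (stair 10 15 m))) (\<lambda>m. alt_sign (int m) :: rat) =
      wgf UNIV (\<lambda>m. int 5 * (int m + 1)\<^sup>2) (\<lambda>m. alt_sign (int m))"
    by (subst wgf_X_power_mult)
       (auto intro!: wgf_cong simp: stair_exponent_10_15)
  then show ?thesis
    unfolding pmex_fps[of 10 15, simplified] theta_0_eq[of 5, simplified] by (simp add: mult_ac)
qed

subsection \<open>Residues modulo 40\<close>

lemma cong_40_iff: "[int m = r] (mod 40) \<longleftrightarrow> m mod 40 = nat (r mod 40)"
proof -
  have "int m mod 40 = int (m mod 40)" by (simp add: zmod_int)
  then show ?thesis
    unfolding cong_def by (metis nat_int nat_0_le pos_mod_sign zero_less_numeral)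
qed

text \<open>Reduces claims about residues to forty evaluations.\<close>

lemma mod_40_cases: "(\<forall>r\<in>set [0..<40]. P r) \<Longrightarrow> P (m mod 40)"
  by (simp del: upt_rec_numeral)

lemma mod_10_mod_20: "m mod 10 = m mod 40 mod 10" "m mod 20 = m mod 40 mod 20" for m :: nat
  by (simp_all add: mod_mod_cancel)

lemma mu_residue_iff: "mu_residue m \<longleftrightarrow> m mod 40 \<in> {8, 12, 28, 32}"
  unfolding mu_residue_def cong_40_iff by auto

text \<open>Apart from 4 and -4, the excluded residues modulo 40 are exactly the lifts of 0, 3, -3
  modulo 10, the classes of \<open>theta 5 2\<close>.\<close>

lemma nu_residue_iff: "nu_residue m \<longleftrightarrow> m mod 10 \<notin> {0, 3, 7} \<and> m mod 40 \<notin> {4, 36}"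
proof -
  have "nu_residue m \<longleftrightarrow> m mod 40 \<notin> {0, 3, 37, 4, 36, 7, 33, 10, 30, 13, 27, 17, 23, 20}"
    unfolding nu_residue_def cong_40_iff by simp
  also have "\<dots> \<longleftrightarrow> m mod 10 \<notin> {0, 3, 7} \<and> m mod 40 \<notin> {4, 36}"
    unfolding mod_10_mod_20[of m] by (rule mod_40_cases) code_simp
  finally show ?thesis .
qed

lemma double_mu_residues: "(*) 2 ` {m. mu_residue m} = {m. m mod 40 \<in> {16, 24}}"
proof (intro equalityI subsetI)
  fix m assume "m \<in> (*) 2 ` {m. mu_residue m}"
  then obtain k where k: "m = 2 * k" "k mod 40 \<in> {8, 12, 28, 32}"
    unfolding mu_residue_iff by auto
  have "m mod 40 = 2 * (k mod 40) mod 40"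
    by (simp add: k(1) mod_mult_right_eq)
  with k(2) show "m \<in> {m. m mod 40 \<in> {16, 24}}"
    by auto
next
  fix m :: nat assume m: "m \<in> {m. m mod 40 \<in> {16, 24}}"
  define k where "k = m div 40"
  have "m = 40 * k + m mod 40" by (simp add: k_def)
  \<comment> \<open>Halving fixes the residue modulo 20 only; the parity of \<open>k\<close> decides
    between its two lifts modulo 40.\<close>
  with m have "m = 2 * (20 * k + 8) \<or> m = 2 * (20 * k + 12)" by force
  moreover have "(20 * k + 8) mod 40 \<in> {8, 28}" "(20 * k + 12) mod 40 \<in> {12, 32}"
    by (cases "even k"; auto elim!: evenE oddE simp: mod_mult_right_eq)+
  ultimately show "m \<in> (*) 2 ` {m. mu_residue m}"
    unfolding mu_residue_iff by blast
qed

lemma theta_5_2: "theta 5 2 = fps_prod {m. m mod 10 \<in> {0, 3, 7}}"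
  using jacobi_triple_product[of 2 5] by (simp add: insert_commute)

text \<open>The classes 8 and -8 modulo 20 lift to 8, -8, 12, -12 modulo 40, the parts allowed in
  \<open>\<mu>\<close>.\<close>

lemma theta_10_2:
  "theta 10 2 = fps_prod {m. mu_residue m} * fps_prod {m. m mod 20 = 0}"
proof -
  have "m mod 20 \<in> {0, 12, 8} \<longleftrightarrow> mu_residue m \<or> m mod 20 = 0" for m
    unfolding mu_residue_iff mod_10_mod_20[of m] by (rule mod_40_cases) code_simp
  then have eq: "{m. m mod 20 \<in> {0, 12, 8 :: nat}} = {m. mu_residue m} \<union> {m. m mod 20 = 0}"
    by blast
  have "theta 10 2 = fps_prod {m. m mod 20 \<in> {0, 12, 8}}"
    using jacobi_triple_product[of 2 10] by simp
  also note eq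
  also have "fps_prod ({m. mu_residue m} \<union> {m. m mod 20 = 0}) = fps_prod {m. mu_residue m} * fps_prod {m. m mod 20 = 0}"
  proof (rule fps_prod_Un)
    have "\<not> (mu_residue m \<and> m mod 20 = 0)" for m
      unfolding mu_residue_iff mod_10_mod_20[of m] by (rule mod_40_cases) code_simp
    then show "{m. mu_residue m} \<inter> {m. m mod 20 = 0} \<subseteq> {0}"
      by (simp only: subset_iff Int_iff Un_iff mem_Collect_eq simp_thms)
  qed
  finally show ?thesis .
qed

text \<open>The classes 4 and -4 modulo 20 lift to 4, -4 modulo 40, excluded for
  \<open>\<nu>\<close>, and to 16, -16, the doubled parts of \<open>\<mu>\<close>.\<close>

lemma theta_10_6:
  "theta 10 6 = fps_prod {m. m mod 40 \<in> {16, 24}} * fps_prod {m. m mod 40 \<in> {4, 36}} *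
    fps_prod {m. m mod 20 = 0}"
proof -
  have "m mod 20 \<in> {0, 16, 4} \<longleftrightarrow> m mod 40 \<in> {16, 24} \<or> m mod 40 \<in> {4, 36} \<or> m mod 20 = 0"
    for m :: nat
    unfolding mod_10_mod_20[of m] by (rule mod_40_cases) code_simp
  then have eq: "{m. m mod 20 \<in> {0, 16, 4 :: nat}} =
      ({m. m mod 40 \<in> {16, 24}} \<union> {m. m mod 40 \<in> {4, 36}}) \<union> {m. m mod 20 = 0}"
    by blast
  have "theta 10 6 = fps_prod {m. m mod 20 \<in> {0, 16, 4}}"
    using jacobi_triple_product[of 6 10] by simp
  also note eq
  also have "fps_prod (({m. m mod 40 \<in> {16, 24}} \<union> {m. m mod 40 \<in> {4, 36}}) \<union> {m. m mod 20 = 0}) = fps_prod ({m. m mod 40 \<in> {16, 24}} \<union> {m. m mod 40 \<in> {4, 36}}) *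
      fps_prod {m. m mod 20 = 0}"
  proof (rule fps_prod_Un)
    have "\<not> ((m mod 40 \<in> {16, 24} \<or> m mod 40 \<in> {4, 36}) \<and> m mod 20 = 0)" for m :: nat
      unfolding mod_10_mod_20[of m] by (rule mod_40_cases) code_simp
    then show "({m. m mod 40 \<in> {16, 24}} \<union> {m. m mod 40 \<in> {4, 36}}) \<inter> {m. m mod 20 = 0} \<subseteq> {0::nat}"
      by (simp only: subset_iff Int_iff Un_iff mem_Collect_eq simp_thms)
  qed
  also have "fps_prod ({m. m mod 40 \<in> {16, 24}} \<union> {m. m mod 40 \<in> {4, 36}}) =
      fps_prod {m. m mod 40 \<in> {16, 24}} * fps_prod {m. m mod 40 \<in> {4, 36}}"
    by (rule fps_prod_Un) auto
  finally show ?thesis .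
qed

lemma fps_prod_UNIV:
  "fps_prod UNIV = fps_prod {m. nu_residue m} * (theta 5 2 * fps_prod {m. m mod 40 \<in> {4, 36}})"
proof -
  have "fps_prod {m. m mod 10 \<in> {0, 3, 7}} * fps_prod {m. m mod 40 \<in> {4, 36}} =
      fps_prod ({m. m mod 10 \<in> {0, 3, 7}} \<union> {m. m mod 40 \<in> {4, 36}})"
  proof (rule fps_prod_Un[symmetric])
    have "\<not> (m mod 10 \<in> {0, 3, 7} \<and> m mod 40 \<in> {4, 36})" for m :: nat
      unfolding mod_10_mod_20[of m] by (rule mod_40_cases) code_simp
    then show "{m. m mod 10 \<in> {0, 3, 7}} \<inter> {m. m mod 40 \<in> {4, 36}} \<subseteq> {0::nat}"
      by (simp only: subset_iff Int_iff Un_iff mem_Collect_eq simp_thms)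
  qed
  moreover have "(UNIV :: nat set) =
      {m. nu_residue m} \<union> ({m. m mod 10 \<in> {0, 3, 7}} \<union> {m. m mod 40 \<in> {4, 36}})"
    unfolding nu_residue_iff by (rule set_eqI, simp only: Un_iff mem_Collect_eq UNIV_I simp_thms) argo
  moreover have "fps_prod ({m. nu_residue m} \<union> ({m. m mod 10 \<in> {0, 3, 7}} \<union> {m. m mod 40 \<in> {4, 36}})) =
      fps_prod {m. nu_residue m} * fps_prod ({m. m mod 10 \<in> {0, 3, 7}} \<union> {m. m mod 40 \<in> {4, 36}})"
    by (rule fps_prod_Un) (auto simp: nu_residue_iff)
  ultimately show ?thesis
    unfolding theta_5_2 by simp
qed

section \<open>Assembly of the product formula\<close>

lemma pmex_difference_mult:
  fixes D :: "rat fps"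
  defines "D \<equiv> Abs_fps (\<lambda>n. of_int (int (pmex 2 3 (int n)) - int (pmex 10 15 (int n - 4))))"
  shows "D * fps_prod {m. nu_residue m} = (\<Prod>m. num_factor m)"
proof -
  define P where "P = partition_fps UNIV"
  define N M E F where "N = fps_prod {m. nu_residue m}" and "M = (\<Prod>m. num_factor m)"
    and "E = theta 5 2 * fps_prod {m. m mod 40 \<in> {4, 36}}" and "F = theta 5 2 * theta 10 6"
  \<comment> \<open>The argument \<open>n - 4\<close> becomes the factor X^4, because
    \<open>pmex\<close> is 0 at negative arguments.\<close>
  have D: "D = Abs_fps (\<lambda>n. of_nat (pmex 2 3 (int n))) -
      fps_X ^ 4 * Abs_fps (\<lambda>n. of_nat (pmex 10 15 (int n)))"
    by (rule fps_ext) (simp add: D_def fps_X_power_mult_nth pmex_neg of_nat_diff)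
  have "2 * fps_X * D = 2 * fps_X * Abs_fps (\<lambda>n. of_nat (pmex 2 3 (int n))) -
      2 * fps_X ^ 5 * Abs_fps (\<lambda>n. of_nat (pmex 10 15 (int n)))"
    unfolding D by (simp add: algebra_simps eval_nat_numeral)
  also have "\<dots> = P * (theta 5 0 - theta 1 0)"
    unfolding pmex_2_3_fps pmex_10_15_fps P_def by (simp add: algebra_simps)
  finally have "2 * fps_X * (D * theta 10 2) = P * ((theta 5 0 - theta 1 0) * theta 10 2)"
    by (simp add: mult_ac)
  also have "\<dots> = 2 * fps_X * (P * F)"
    unfolding theta_difference F_def by (simp only: mult_ac)
  finally have *: "D * theta 10 2 = P * F"
    by simp
  \<comment> \<open>\<open>E\<close> collects the exponents outside \<open>N\<close>, so that
    \<open>N * E\<close> cancels the partition series \<open>P\<close>.\<close>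
  have "(D * N) * (theta 10 2 * E) = (D * theta 10 2) * (N * E)"
    by (simp only: mult_ac)
  also have "\<dots> = (P * (N * E)) * F"
    unfolding * by (simp only: mult_ac)
  also have "N * E = fps_prod UNIV"
    unfolding N_def E_def fps_prod_UNIV ..
  also have "P * fps_prod UNIV = 1"
    unfolding P_def by (rule partition_fps_mult_fps_prod)
  \<comment> \<open>Both sides are \<open>theta 5 2\<close> times the Euler products over 16, -16,
    4, -4 modulo 40 and 0 modulo 20.\<close>
  also have "1 * F = M * (theta 10 2 * E)"
  proof -
    have "M * (theta 10 2 * E) = (M * fps_prod {m. mu_residue m}) * (fps_prod {m. m mod 20 = 0} * E)"
      unfolding theta_10_2 by (simp only: mult_ac)
    also have "M * fps_prod {m. mu_residue m} = fps_prod {m. m mod 40 \<in> {16, 24}}"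
      unfolding M_def prodinf_num_factor_mult double_mu_residues ..
    finally show ?thesis
      unfolding F_def E_def theta_10_6 by (simp only: mult_ac mult_1_left)
  qed
  finally have "(D * N) * (theta 10 2 * E) = M * (theta 10 2 * E)" .
  moreover have "theta 10 2 * E \<noteq> 0"
    by (simp add: theta_10_2 E_def theta_5_2)
  ultimately show ?thesis
    by (simp add: N_def M_def)
qed

theorem theorem3p13:
  shows "(\<forall>n::nat. int (pmex 2 3 (int n)) - int (pmex 10 15 (int n - 4)) = int (card (partition_pairs n)))
    \<and> Abs_fps (\<lambda>n. of_int (int (pmex 2 3 (int n)) - int (pmex 10 15 (int n - 4))) :: rat)
        = (\<Prod>m. num_factor m) / (\<Prod>m. den_factor m)"
proof -
  define D :: "rat fps"
    where "D = Abs_fps (\<lambda>n. of_int (int (pmex 2 3 (int n)) - int (pmex 10 15 (int n - 4))))"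
  define N where "N = fps_prod {m. nu_residue m}"
  have N: "(\<Prod>m. den_factor m) = N" "N \<noteq> 0"
    unfolding N_def by (simp add: fps_prod_def den_factor_def) simp
  have D: "D * N = (\<Prod>m. num_factor m)"
    unfolding D_def N_def by (rule pmex_difference_mult)
  \<comment> \<open>The series of the pairs has the same product with \<open>N\<close> as
    \<open>D\<close>, since the series of \<open>\<nu>\<close> is inverse to \<open>N\<close>;
    cancelling the nonzero \<open>N\<close> identifies the two.\<close>
  have "Abs_fps (\<lambda>n. of_nat (card (partition_pairs n))) * N =
      (\<Prod>m. num_factor m) * (partition_fps {m. nu_residue m} * fps_prod {m. nu_residue m})"
    unfolding partition_pairs_fps distinct_partition_fps_eq N_def by (simp only: mult.assoc)
  then have "D * N = Abs_fps (\<lambda>n. of_nat (card (partition_pairs n))) * N"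
    by (simp add: D partition_fps_mult_fps_prod)
  then have *: "D = Abs_fps (\<lambda>n. of_nat (card (partition_pairs n)))"
    using N(2) by simp
  have "int (pmex 2 3 (int n)) - int (pmex 10 15 (int n - 4)) = int (card (partition_pairs n))" for n
  proof -
    have "(of_int (int (pmex 2 3 (int n)) - int (pmex 10 15 (int n - 4))) :: rat) =
        of_int (int (card (partition_pairs n)))"
      using arg_cong[OF *, of "\<lambda>f. fps_nth f n"] by (simp add: D_def)
    then show ?thesis by (simp only: of_int_eq_iff)
  qed
  moreover have "D = (\<Prod>m. num_factor m) / (\<Prod>m. den_factor m)"
    unfolding N(1) D[symmetric] using N(2) by simp
  ultimately show ?thesis
    unfolding D_def by blast
qed

end
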